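(* Let $(G,\tau)$ be a countable totally bounded metrizable abelian topological group. Then there exists a sequence $\underline{u} = \langle u_n : n \in \omega\rangle$ of elements of $G$ with $u_n \to 0$ in $(G,\tau)$ such that $\tau$ is the finest totally bounded group topology on $G$ in which $u_n \to 0$.
   Context: All topological groups are Hausdorff; abelian groups are written additively. A topological group is totally bounded if for every neighborhood $U$ of $0$ it is covered by finitely many translates of $U$; a totally bounded group topology on $G$ is a group topology making $G$ a totally bounded topological group. "Finest" means that $\tau' \subseteq \tau$ for every totally bounded group topology $\tau'$ on $G$ in which $u_n \to 0$. *)

theory Defs
  imports "HOL-Analysis.Analysis"
begin

text \<open>
  The abelian group is the whole type; the topology is an explicit \<open>'a topology\<close> rather than the one
  of a type class, because different topologies on the same group are compared.
  All topological groups are Hausdorff.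
\<close>

definition group_topology :: "'a::ab_group_add topology \<Rightarrow> bool" where
  "group_topology T \<longleftrightarrow>
     topspace T = UNIV \<and>
     Hausdorff_space T \<and>
     continuous_map (prod_topology T T) T (\<lambda>(x, y). x + y) \<and>
     continuous_map T T uminus"

definition nbhd_zero :: "'a::ab_group_add topology \<Rightarrow> 'a set \<Rightarrow> bool" where
  "nbhd_zero T U \<longleftrightarrow> (\<exists>V. openin T V \<and> 0 \<in> V \<and> V \<subseteq> U)"

definition tb_group_topology :: "'a::ab_group_add topology \<Rightarrow> bool" where
  "tb_group_topology T \<longleftrightarrow>
     group_topology T \<and>
     (\<forall>U. nbhd_zero T U \<longrightarrow> (\<exists>F. finite F \<and> UNIV \<subseteq> (\<Union>x\<in>F. (\<lambda>y. x + y) ` U)))"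

definition coarser_topology :: "'a topology \<Rightarrow> 'a topology \<Rightarrow> bool" where
  "coarser_topology T' T \<longleftrightarrow> {U. openin T' U} \<subseteq> {U. openin T U}"

definition finest_tb_group_topology_null ::
    "'a::ab_group_add topology \<Rightarrow> (nat \<Rightarrow> 'a) \<Rightarrow> bool" where
  "finest_tb_group_topology_null T u \<longleftrightarrow>
     tb_group_topology T \<and> limitin T u 0 sequentially \<and>
     (\<forall>T'. tb_group_topology T' \<and> limitin T' u 0 sequentially \<longrightarrow> coarser_topology T' T)"

end

theory Submission
  imports Defs
begin

text \<open>
  Two facts are combined. First, in a totally bounded group every neighbourhood of zero contains one
  defined by finitely many continuous characters. For this a uniformly continuous bump is
  autocorrelated into a continuous positive definite function \<open>\<phi>\<close>. If \<open>\<phi>\<close> is not small in quadratic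
  mean, maximizing a quadratic form attached to \<open>\<phi>\<close> and to a Folner family over the normalized
  positive definite functions produces, in the limit, a character \<open>\<xi>\<close> and a constant \<open>\<delta> > 0\<close> for
  which \<open>\<phi> - \<delta> \<xi>\<close> is still positive definite; finitely many such steps exhaust \<open>\<phi>\<close>.

  Second, let \<open>A n\<close> be a decreasing base at zero of \<open>T\<close>. Total boundedness makes the polar of \<open>A n\<close>, a
  set of continuous characters, finite. As the characters of a countable group form a
  compact metrizable space, finite sets \<open>F n \<subseteq> A n\<close> can be chosen such that a character lying in the
  polars of almost all \<open>F n\<close> lies in the polar of some \<open>A m\<close>. A sequence enumerating the \<open>F n\<close> one
  after the other converges to zero in \<open>T\<close>, and every character along which it converges to \<open>1\<close> is
  \<open>T\<close>-continuous. This applies to the characters which define a given totally bounded topology in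
  which the sequence is null.
\<close>

subsection \<open>Positive definite functions\<close>

text \<open>The sesquilinear form of the kernel \<open>\<phi> (x - y)\<close> on finitely supported
  measures. Two index families are allowed, so that mixed terms can be written as well.\<close>

definition pd_form :: "('a::ab_group_add \<Rightarrow> complex) \<Rightarrow> 'b set \<Rightarrow> ('b \<Rightarrow> complex) \<Rightarrow> ('b \<Rightarrow> 'a) \<Rightarrow>
    'c set \<Rightarrow> ('c \<Rightarrow> complex) \<Rightarrow> ('c \<Rightarrow> 'a) \<Rightarrow> complex" where
  "pd_form \<phi> I c x J d y = (\<Sum>i\<in>I. \<Sum>j\<in>J. cnj (c i) * d j * \<phi> (x i - y j))"

text \<open>Only the real part of the form is compared with zero; Hermitian symmetry is what makes
  its diagonal values real.\<close>

definition pos_def :: "('a::ab_group_add \<Rightarrow> complex) \<Rightarrow> bool" where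
  "pos_def \<phi> \<longleftrightarrow> (\<forall>x. \<phi> (- x) = cnj (\<phi> x)) \<and>
     (\<forall>n (c :: nat \<Rightarrow> complex) x. 0 \<le> Re (pd_form \<phi> {..<n} c x {..<n} c x))"

text \<open>These are the characters of the discrete group, a closed set for pointwise convergence.
  Continuity is expressed separately, by neighbourhoods of zero.\<close>

definition circle_char :: "('a::ab_group_add \<Rightarrow> complex) \<Rightarrow> bool" where
  "circle_char \<xi> \<longleftrightarrow> (\<forall>x y. \<xi> (x + y) = \<xi> x * \<xi> y) \<and> (\<forall>x. cmod (\<xi> x) = 1)"

lemma circle_char_add: "circle_char \<xi> \<Longrightarrow> \<xi> (x + y) = \<xi> x * \<xi> y"
  and circle_char_norm: "circle_char \<xi> \<Longrightarrow> cmod (\<xi> x) = 1"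
  by (auto simp: circle_char_def)

lemma circle_char_0: "circle_char \<xi> \<Longrightarrow> \<xi> 0 = 1"
  by (metis add.right_neutral circle_char_add circle_char_norm mult_cancel_left2 norm_zero zero_neq_one)

lemma circle_char_minus: "circle_char \<xi> \<Longrightarrow> \<xi> (- x) = cnj (\<xi> x)"
proof -
  assume \<xi>: "circle_char \<xi>"
  have "\<xi> (- x) * \<xi> x = cnj (\<xi> x) * \<xi> x"
    using circle_char_add[OF \<xi>, of "- x" x] circle_char_0[OF \<xi>] circle_char_norm[OF \<xi>, of x]
    by (simp add: mult.commute complex_norm_square[symmetric])
  moreover have "\<xi> x \<noteq> 0" using circle_char_norm[OF \<xi>, of x] by auto
  ultimately show ?thesis by simp
qed

lemma circle_char_diff: "circle_char \<xi> \<Longrightarrow> \<xi> (x - y) = \<xi> x * cnj (\<xi> y)"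
  by (metis circle_char_add circle_char_minus diff_conv_add_uminus)

text \<open>The kernel of a character factors, so its form has rank one.\<close>

lemma pd_form_circle_char:
  assumes "circle_char \<xi>"
  shows "pd_form \<xi> I c x J d y = cnj (\<Sum>i\<in>I. c i * cnj (\<xi> (x i))) * (\<Sum>j\<in>J. d j * cnj (\<xi> (y j)))"
  by (simp add: pd_form_def circle_char_diff[OF assms] sum_product cnj_sum algebra_simps)

lemma pd_form_reindex:
  assumes "bij_betw h I' I"
  shows "pd_form \<phi> I c x I c x = pd_form \<phi> I' (c \<circ> h) (x \<circ> h) I' (c \<circ> h) (x \<circ> h)"
proof -
  have 1: "(\<Sum>j\<in>I. f j) = (\<Sum>j\<in>I'. f (h j))" for f :: "_ \<Rightarrow> complex"
    using sum.reindex_bij_betw[OF assms, of f] by simp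
  show ?thesis
    unfolding pd_form_def 1 by simp
qed

lemma pos_defD:
  assumes "pos_def \<phi>" "finite I"
  shows "0 \<le> Re (pd_form \<phi> I c x I c x)"
proof -
  obtain h where "bij_betw h {..<card I} I"
    using assms(2) bij_betw_from_nat_into_finite by blast
  then show ?thesis using assms(1) by (auto simp: pd_form_reindex pos_def_def)
qed

lemma pos_def_minus: "pos_def \<phi> \<Longrightarrow> \<phi> (- x) = cnj (\<phi> x)"
  by (simp add: pos_def_def)

lemma pos_def_minus_diff: "pos_def \<phi> \<Longrightarrow> \<phi> (x - y) = cnj (\<phi> (y - x))"
  by (metis minus_diff_eq pos_def_minus)

lemma pd_form_cnj:
  assumes "pos_def \<phi>"
  shows "pd_form \<phi> J d y I c x = cnj (pd_form \<phi> I c x J d y)"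
proof -
  have *: "cnj (cnj (c i) * d j * \<phi> (x i - y j)) = cnj (d j) * c i * \<phi> (y j - x i)" for i j
    using pos_def_minus_diff[OF assms, of "y j" "x i"] by simp
  show ?thesis unfolding pd_form_def cnj_sum * by (rule sum.swap)
qed

lemma pd_form_Plus:
  assumes "finite I" "finite J" "pos_def \<phi>"
  shows "Re (pd_form \<phi> (I <+> J) (case_sum c d) (case_sum x y) (I <+> J) (case_sum c d) (case_sum x y))
    = Re (pd_form \<phi> I c x I c x) + 2 * Re (pd_form \<phi> I c x J d y) + Re (pd_form \<phi> J d y J d y)"
proof -
  have "pd_form \<phi> (I <+> J) (case_sum c d) (case_sum x y) (I <+> J) (case_sum c d) (case_sum x y)
    = pd_form \<phi> I c x I c x + pd_form \<phi> I c x J d y + pd_form \<phi> J d y I c x + pd_form \<phi> J d y J d y"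
    using assms by (simp add: pd_form_def sum.Plus sum.distrib)
  then show ?thesis by (simp add: pd_form_cnj[OF assms(3), of J d y I c x])
qed

lemma pd_form_scale_right: "pd_form \<phi> I c x J (\<lambda>j. s * d j) y = s * pd_form \<phi> I c x J d y"
  by (simp add: pd_form_def sum_distrib_left mult.commute mult.left_commute)

lemma pd_form_scale_left: "pd_form \<phi> I (\<lambda>j. s * c j) x J d y = cnj s * pd_form \<phi> I c x J d y"
  by (simp add: pd_form_def sum_distrib_left mult.commute mult.left_commute)

lemma pd_form_add_right:
  "pd_form \<phi> I c x J (\<lambda>j. d j + e j) y = pd_form \<phi> I c x J d y + pd_form \<phi> I c x J e y"
  by (simp add: pd_form_def sum.distrib algebra_simps)

lemma pd_form_add_left:
  "pd_form \<phi> I (\<lambda>j. c j + e j) x J d y = pd_form \<phi> I c x J d y + pd_form \<phi> I e x J d y"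
  by (simp add: pd_form_def sum.distrib algebra_simps)

text \<open>The form is nonnegative on the concatenation of \<open>c\<close> with \<open>s\<close>
  times \<open>d\<close>, for each complex \<open>s\<close>; the discriminant argument
  follows.\<close>

lemma pd_form_Cauchy_Schwarz:
  assumes \<phi>: "pos_def \<phi>" and I: "finite I" and J: "finite J"
  shows "(cmod (pd_form \<phi> I c x J d y))\<^sup>2 \<le> Re (pd_form \<phi> I c x I c x) * Re (pd_form \<phi> J d y J d y)"
proof -
  define A B D where "A = Re (pd_form \<phi> I c x I c x)" and "B = pd_form \<phi> I c x J d y"
    and "D = Re (pd_form \<phi> J d y J d y)"
  have *: "0 \<le> A + 2 * Re (s * B) + (cmod s)\<^sup>2 * D" for s
  proof -
    have "0 \<le> A + 2 * Re (pd_form \<phi> I c x J (\<lambda>j. s * d j) y) + Re (pd_form \<phi> J (\<lambda>j. s * d j) y J (\<lambda>j. s * d j) y)"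
      using pos_defD[OF \<phi>, of "I <+> J"] pd_form_Plus[OF I J \<phi>] I J
      unfolding A_def by (metis finite_Plus)
    moreover have "cnj s * s = of_real ((cmod s)\<^sup>2)"
      by (metis complex_norm_square mult.commute)
    then have "pd_form \<phi> J (\<lambda>j. s * d j) y J (\<lambda>j. s * d j) y = of_real ((cmod s)\<^sup>2) * pd_form \<phi> J d y J d y"
      by (metis pd_form_scale_left pd_form_scale_right mult.assoc)
    then have "Re (pd_form \<phi> J (\<lambda>j. s * d j) y J (\<lambda>j. s * d j) y) = (cmod s)\<^sup>2 * D"
      by (simp add: D_def del: of_real_power)
    ultimately show ?thesis by (simp only: B_def pd_form_scale_right)
  qed
  have D: "0 \<le> D" and A: "0 \<le> A" unfolding D_def A_def using pos_defD[OF \<phi>] I J by auto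
  \<comment> \<open>Putting \<open>s = - t * cnj B\<close> gives a real polynomial in
    \<open>t\<close>. It is affine if \<open>D = 0\<close>, which forces \<open>B = 0\<close>;
    otherwise \<open>t = 1 / D\<close> minimizes it.\<close>
  have t: "0 \<le> A - 2 * t * (cmod B)\<^sup>2 + t\<^sup>2 * (cmod B)\<^sup>2 * D" for t
    using *[of "- of_real t * cnj B"] complex_norm_square[of B]
    by (simp add: norm_mult power_mult_distrib mult.commute mult.left_commute Re_complex_of_real
        flip: of_real_mult of_real_power) (simp add: power2_eq_square cmod_power2[unfolded power2_eq_square] algebra_simps)
  have "(cmod B)\<^sup>2 \<le> A * D"
  proof (cases "D = 0")
    case True
    have "(cmod B)\<^sup>2 = 0"
    proof (rule ccontr)
      assume "(cmod B)\<^sup>2 \<noteq> 0"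
      then obtain s where "s * (cmod B)\<^sup>2 = A + 1" by (metis nonzero_eq_divide_eq)
      moreover have "0 \<le> A - 2 * (s * (cmod B)\<^sup>2)" using t[of s] True by (simp add: mult.assoc)
      ultimately show False using A by simp
    qed
    then show ?thesis using True by simp
  next
    case False
    then have "D > 0" using D by simp
    then show ?thesis using t[of "1 / D"] by (simp add: power2_eq_square field_simps)
  qed
  then show ?thesis by (simp add: A_def B_def D_def)
qed

text \<open>A unit mass at \<open>z\<close> turns the form into a convolution with
  \<open>\<phi>\<close>, so that Cauchy-Schwarz bounds pointwise values.\<close>

lemma pd_form_point:
  "pd_form \<phi> {z} (\<lambda>_. 1) (\<lambda>x. x) J d y = (\<Sum>j\<in>J. d j * \<phi> (z - y j))"
  by (simp add: pd_form_def)

lemma pos_def_0: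
  assumes "pos_def \<phi>"
  shows "\<phi> 0 = of_real (Re (\<phi> 0))" "0 \<le> Re (\<phi> 0)"
proof -
  show "\<phi> 0 = of_real (Re (\<phi> 0))"
    using pos_def_minus[OF assms, of 0] by (simp add: complex_eq_iff)
  show "0 \<le> Re (\<phi> 0)"
    using pos_defD[OF assms, of "{0::nat}" "\<lambda>_. 1" "\<lambda>_. 0"] by (simp add: pd_form_def)
qed

lemma pos_def_norm_le:
  assumes "pos_def \<phi>"
  shows "cmod (\<phi> x) \<le> Re (\<phi> 0)"
proof -
  have "(cmod (\<phi> x))\<^sup>2 \<le> (Re (\<phi> 0))\<^sup>2"
    using pd_form_Cauchy_Schwarz[OF assms, of "{x}" "{0}" "\<lambda>_. 1" "\<lambda>x. x" "\<lambda>_. 1" "\<lambda>x. x"]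
    by (simp add: pd_form_def power2_eq_square)
  then show ?thesis using pos_def_0[OF assms] power2_le_imp_le by blast
qed

lemma pos_def_circle_char: "circle_char \<xi> \<Longrightarrow> pos_def \<xi>"
  unfolding pos_def_def
  by (auto simp: circle_char_minus pd_form_circle_char complex_norm_square[symmetric] mult.commute[of "cnj _"] simp del: cnj_sum)

lemma pos_def_const_1: "pos_def (\<lambda>_. 1)"
  by (rule pos_def_circle_char) (simp add: circle_char_def)

lemma pd_form_add: "pd_form (\<lambda>x. \<phi> x + \<psi> x) I c x J d y = pd_form \<phi> I c x J d y + pd_form \<psi> I c x J d y"
  by (simp add: pd_form_def sum.distrib algebra_simps)

lemma pd_form_diff: "pd_form (\<lambda>x. \<phi> x - \<psi> x) I c x J d y = pd_form \<phi> I c x J d y - pd_form \<psi> I c x J d y"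
  by (simp add: pd_form_def sum_subtractf algebra_simps)

lemma pd_form_mult: "pd_form (\<lambda>x. s * \<phi> x) I c x J d y = s * pd_form \<phi> I c x J d y"
  by (simp add: pd_form_def sum_distrib_left algebra_simps)

lemma pos_def_scale:
  assumes "pos_def \<phi>" "0 \<le> (s::real)"
  shows "pos_def (\<lambda>x. of_real s * \<phi> x)"
  using assms unfolding pos_def_def pd_form_mult by simp

text \<open>The perturbation is the real part of a translate; it is dominated by \<open>\<psi>\<close> because both
  diagonal terms of the Cauchy--Schwarz inequality for \<open>\<psi>\<close> are translation invariant.\<close>

lemma pos_def_perturb:
  assumes \<psi>: "pos_def \<psi>" and c: "cmod c \<le> 1"
  shows "pos_def (\<lambda>x. \<psi> x + (c * \<psi> (x + a) + cnj c * \<psi> (x - a)) / 2)"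
  unfolding pos_def_def
proof (intro conjI allI)
  fix x
  have "\<psi> (- x + a) = cnj (\<psi> (x - a))" "\<psi> (- x - a) = cnj (\<psi> (x + a))"
    using pos_def_minus[OF \<psi>, of "x - a"] pos_def_minus[OF \<psi>, of "x + a"] by simp_all
  then show "\<psi> (- x) + (c * \<psi> (- x + a) + cnj c * \<psi> (- x - a)) / 2 =
    cnj (\<psi> x + (c * \<psi> (x + a) + cnj c * \<psi> (x - a)) / 2)"
    by (simp add: pos_def_minus[OF \<psi>])
next
  fix n :: nat and f :: "nat \<Rightarrow> complex" and x
  let ?I = "{..<n}"
  define A where "A = Re (pd_form \<psi> ?I f x ?I f x)"
  define B where "B = pd_form \<psi> ?I f (\<lambda>i. x i + a) ?I f x"
  have "pd_form \<psi> ?I f (\<lambda>i. x i + a) ?I f (\<lambda>i. x i + a) = pd_form \<psi> ?I f x ?I f x"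
    by (simp add: pd_form_def)
  then have "(cmod B)\<^sup>2 \<le> A\<^sup>2"
    using pd_form_Cauchy_Schwarz[OF \<psi>, of ?I ?I f "\<lambda>i. x i + a" f x] by (simp add: A_def B_def power2_eq_square)
  moreover have A: "0 \<le> A" by (simp add: A_def pos_defD[OF \<psi>])
  ultimately have BA: "cmod B \<le> A" using power2_le_imp_le by blast
  have 1: "pd_form (\<lambda>x. \<psi> (x + a)) ?I f x ?I f x = B"
    by (simp add: pd_form_def B_def algebra_simps)
  have 2: "pd_form (\<lambda>x. \<psi> (x - a)) ?I f x ?I f x = cnj B"
    unfolding B_def pd_form_cnj[OF \<psi>, of ?I f x ?I f "\<lambda>i. x i + a", symmetric]
    by (simp add: pd_form_def algebra_simps)
  have "pd_form (\<lambda>x. \<psi> x + (c * \<psi> (x + a) + cnj c * \<psi> (x - a)) / 2) ?I f x ?I f x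
     = pd_form \<psi> ?I f x ?I f x + pd_form (\<lambda>x. (c/2) * \<psi> (x + a)) ?I f x ?I f x
       + pd_form (\<lambda>x. (cnj c/2) * \<psi> (x - a)) ?I f x ?I f x"
    by (simp add: pd_form_add[symmetric] add_divide_distrib add.assoc)
  also have "Re \<dots> = A + Re (c * B)"
    unfolding pd_form_mult 1 2 by (simp add: A_def)
  also have "Re (c * B) \<ge> - cmod (c * B)"
    by (metis abs_Re_le_cmod abs_le_D2 minus_le_iff)
  moreover have "cmod (c * B) \<le> A"
    using BA c by (metis mult_left_le_one_le norm_ge_zero norm_mult order_trans)
  ultimately show "0 \<le> Re (pd_form (\<lambda>x. \<psi> x + (c * \<psi> (x + a) + cnj c * \<psi> (x - a)) / 2) ?I f x ?I f x)"
    by linarith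
qed

section \<open>Compactness and extremal positive definite functions\<close>

lemma compact_bounded_functions:
  "compact {\<psi> :: 'a \<Rightarrow> complex. \<forall>x. cmod (\<psi> x) \<le> b}"
proof -
  have "compactin (product_topology (\<lambda>_. euclidean) UNIV) (PiE UNIV (\<lambda>_::'a. cball (0::complex) b))"
    by (subst compactin_PiE) auto
  moreover have "PiE UNIV (\<lambda>_::'a. cball (0::complex) b) = {\<psi>. \<forall>x. cmod (\<psi> x) \<le> b}"
    by (auto simp: PiE_def Pi_def)
  ultimately show ?thesis
    by (simp add: euclidean_product_topology)
qed

text \<open>With this rule, sets cut out by pointwise equations and inequalities are recognized as
  closed in the product topology.\<close>

lemma continuous_on_apply [continuous_intros]:
  fixes f :: "'b::topological_space \<Rightarrow> 'a \<Rightarrow> 'c::topological_space"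
  assumes "continuous_on S f"
  shows "continuous_on S (\<lambda>z. f z x)"
  using assms by (rule continuous_on_product_then_coordinatewise)

lemma pos_def_closed: "closed {\<psi>. pos_def \<psi>}"
  unfolding pos_def_def pd_form_def
  by (intro closed_Collect_conj closed_Collect_all closed_Collect_eq closed_Collect_le continuous_intros)

text \<open>Normalization bounds the functions by one, so they form a closed subset of a compact
  product of discs.\<close>

lemma pos_def_maximizer_exists:
  fixes F :: "('a::ab_group_add \<Rightarrow> complex) \<Rightarrow> real"
  assumes "continuous_on UNIV F"
  shows "\<exists>\<psi>. pos_def \<psi> \<and> \<psi> 0 = 1 \<and> (\<forall>\<psi>'. pos_def \<psi>' \<longrightarrow> \<psi>' 0 = 1 \<longrightarrow> F \<psi>' \<le> F \<psi>)"
proof -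
  let ?D = "{\<psi> :: 'a \<Rightarrow> complex. pos_def \<psi> \<and> \<psi> 0 = 1}"
  have "closed ?D"
    by (intro closed_Collect_conj pos_def_closed closed_Collect_eq continuous_intros)
  then have "compact ({\<psi>. \<forall>x. cmod (\<psi> x) \<le> 1} \<inter> ?D)"
    by (rule compact_Int_closed[OF compact_bounded_functions])
  moreover have "{\<psi>. \<forall>x. cmod (\<psi> x) \<le> 1} \<inter> ?D = ?D"
    by (auto intro: order_trans[OF pos_def_norm_le])
  ultimately have "compact ?D" by (simp only:)
  moreover have "?D \<noteq> {}" using pos_def_const_1 by auto
  ultimately have "\<exists>\<psi>\<in>?D. \<forall>\<psi>'\<in>?D. F \<psi>' \<le> F \<psi>"
    using assms by (intro continuous_attains_sup) (auto intro: continuous_on_subset)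
  then show ?thesis by blast
qed

text \<open>At a maximizer \<open>\<psi>\<close> of the quadratic form \<open>q\<close>, a perturbation \<open>\<eta>\<close> of either sign is admissible.
  Writing \<open>\<psi> \<plusminus> \<eta> = (1 \<plusminus> \<eta> 0) \<psi> \<plusminus> \<zeta>\<close>, maximality and homogeneity force \<open>q \<zeta> = 0\<close>, and then
  the Cauchy--Schwarz inequality makes the convolution of \<open>\<zeta>\<close> with \<open>\<phi>\<close> vanish identically.\<close>

lemma pos_def_maximizer_eigenvector:
  fixes \<phi> :: "'a::ab_group_add \<Rightarrow> complex" and p :: "'i \<Rightarrow> 'a"
  assumes \<phi>: "pos_def \<phi>" and I: "finite I"
  defines "q \<equiv> (\<lambda>\<psi>. Re (pd_form \<phi> I (\<lambda>i. \<psi> (p i)) p I (\<lambda>i. \<psi> (p i)) p))"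
  assumes \<psi>: "pos_def \<psi>" "\<psi> 0 = 1" and max: "\<And>\<psi>'. pos_def \<psi>' \<Longrightarrow> \<psi>' 0 = 1 \<Longrightarrow> q \<psi>' \<le> q \<psi>"
  shows "(\<Sum>i\<in>I. \<psi> (p i + a) * \<phi> (x - p i)) = \<psi> a * (\<Sum>i\<in>I. \<psi> (p i) * \<phi> (x - p i))"
proof -
  define \<theta> where "\<theta> f = (\<Sum>i\<in>I. f (p i) * \<phi> (x - p i))" for f
  define \<eta> where "\<eta> c y = (c * \<psi> (y + a) + cnj c * \<psi> (y - a)) / 2" for c y
  have \<psi>a: "\<psi> (- a) = cnj (\<psi> a)" using pos_def_minus[OF \<psi>(1)] .
  \<comment> \<open>The bound 1/2 keeps \<open>1 + r\<close> and \<open>1 - r\<close> positive, so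
    that both perturbations can be normalized.\<close>
  have key: "\<theta> (\<eta> c) = of_real (Re (c * \<psi> a)) * \<theta> \<psi>" if c: "cmod c \<le> 1/2" for c
  proof -
    define r where "r = Re (c * \<psi> a)"
    have \<eta>0: "\<eta> c 0 = of_real r"
      by (simp add: \<eta>_def r_def \<psi>a complex_eq_iff)
    have "cmod (\<psi> a) \<le> 1" using pos_def_norm_le[OF \<psi>(1), of a] \<psi>(2) by simp
    then have "cmod (c * \<psi> a) \<le> 1/2"
      using c mult_mono[of "cmod c" "1/2" "cmod (\<psi> a)" 1] by (simp add: norm_mult)
    then have r: "\<bar>r\<bar> \<le> 1/2" unfolding r_def using abs_Re_le_cmod order_trans by blast
    define \<zeta> where "\<zeta> y = \<eta> c y - of_real r * \<psi> y" for y
    define \<beta> where "\<beta> = Re (pd_form \<phi> I (\<lambda>i. \<psi> (p i)) p I (\<lambda>i. \<zeta> (p i)) p)"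
    have q_lin: "q (\<lambda>y. of_real s * \<psi> y + of_real t * \<zeta> y) = s\<^sup>2 * q \<psi> + 2 * s * t * \<beta> + t\<^sup>2 * q \<zeta>" for s t
      unfolding q_def \<beta>_def pd_form_add_left pd_form_add_right pd_form_scale_left pd_form_scale_right
      using pd_form_cnj[OF \<phi>, of I "\<lambda>i. \<zeta> (p i)" p I "\<lambda>i. \<psi> (p i)" p]
      by (simp add: power2_eq_square algebra_simps)
    have ineq: "2 * (1 + t * r) * t * \<beta> + q \<zeta> \<le> 0" if t: "\<bar>t\<bar> = 1" for t :: real
    proof -
      define \<psi>' where "\<psi>' y = \<psi> y + ((of_real t * c) * \<psi> (y + a) + cnj (of_real t * c) * \<psi> (y - a)) / 2" for y
      have \<psi>': "\<psi>' = (\<lambda>y. of_real (1 + t * r) * \<psi> y + of_real t * \<zeta> y)"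
        by (auto simp: \<psi>'_def \<zeta>_def \<eta>_def algebra_simps add_divide_distrib)
      have tr: "\<bar>t * r\<bar> < 1" using r t by (simp add: abs_mult)
      then have pos: "1 + t * r > 0" by linarith
      have "cmod (of_real t * c) \<le> 1" using c t by (simp add: norm_mult)
      then have "pos_def \<psi>'"
        unfolding \<psi>'_def by (rule pos_def_perturb[OF \<psi>(1)])
      then have "pos_def (\<lambda>y. of_real (1 / (1 + t * r)) * \<psi>' y)"
        using pos by (intro pos_def_scale) auto
      moreover have "\<psi>' 0 = of_real (1 + t * r)"
        using \<eta>0 \<psi>(2) by (simp add: \<psi>' \<zeta>_def)
      then have "of_real (1 / (1 + t * r)) * \<psi>' 0 = 1"
        using pos by (simp flip: of_real_mult del: of_real_add)
      ultimately have "q (\<lambda>y. of_real (1 / (1 + t * r)) * \<psi>' y) \<le> q \<psi>" by (rule max)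
      also have "q (\<lambda>y. of_real (1 / (1 + t * r)) * \<psi>' y) = (1 / (1 + t * r))\<^sup>2 * q \<psi>'"
        unfolding q_def pd_form_scale_left pd_form_scale_right complex_cnj_complex_of_real
        by (simp only: Re_complex_of_real times_complex.sel Im_complex_of_real) (simp add: power2_eq_square)
      finally have "q \<psi>' \<le> (1 + t * r)\<^sup>2 * q \<psi>"
        using pos by (simp add: field_simps)
      moreover have "q \<psi>' = (1 + t * r)\<^sup>2 * q \<psi> + 2 * (1 + t * r) * t * \<beta> + t\<^sup>2 * q \<zeta>"
        unfolding \<psi>' by (rule q_lin)
      moreover have "t\<^sup>2 = 1" using t by (metis one_power2 power2_abs)
      ultimately show ?thesis by simp
    qed
    \<comment> \<open>The sign of \<open>t\<close> is chosen so that the term linear in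
      \<open>\<beta>\<close> is nonnegative.\<close>
    have "q \<zeta> \<le> 0"
    proof (cases "\<beta> \<ge> 0")
      case True
      then have "0 \<le> 2 * (1 + r) * \<beta>" using r by simp
      then show ?thesis using ineq[of 1] by simp
    next
      case False
      then have "2 * (1 - r) * \<beta> \<le> 0" using r by (intro mult_nonneg_nonpos) auto
      then show ?thesis using ineq[of "-1"] by (simp add: algebra_simps)
    qed
    moreover have "(cmod (\<theta> \<zeta>))\<^sup>2 \<le> Re (\<phi> 0) * q \<zeta>"
      using pd_form_Cauchy_Schwarz[OF \<phi> _ I, of "{x}" "\<lambda>_. 1" "\<lambda>x. x" "\<lambda>i. \<zeta> (p i)" p]
      unfolding pd_form_point by (simp add: \<theta>_def q_def)
    ultimately have "\<theta> \<zeta> = 0"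
      by (smt (verit) mult_nonneg_nonpos norm_eq_zero pos_def_0(2)[OF \<phi>] zero_eq_power2 zero_le_power2)
    moreover have "\<theta> \<zeta> = \<theta> (\<eta> c) - of_real r * \<theta> \<psi>"
      by (simp add: \<theta>_def \<zeta>_def sum_subtractf sum_distrib_left left_diff_distrib mult.assoc)
    ultimately show ?thesis by (simp only: r_def right_minus_eq)
  qed
  \<comment> \<open>The values \<open>c = 1/2\<close> and \<open>c = \<i>/2\<close> in
    \<open>key\<close> determine the sum and the difference of \<open>P\<close> and
    \<open>M\<close>, hence \<open>P\<close>.\<close>
  define P where "P = \<theta> (\<lambda>y. \<psi> (y + a))"
  define M where "M = \<theta> (\<lambda>y. \<psi> (y - a))"
  have \<theta>\<eta>: "\<theta> (\<eta> c) = (c * P + cnj c * M) / 2" for c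
    by (simp add: \<theta>_def \<eta>_def P_def M_def sum_distrib_left sum_divide_distrib sum.distrib add_divide_distrib algebra_simps)
  have "P + M = 2 * of_real (Re (\<psi> a)) * \<theta> \<psi>"
    using key[of "1/2"] unfolding \<theta>\<eta> by (simp add: algebra_simps)
  moreover have "\<i> * (P - M) = - 2 * of_real (Im (\<psi> a)) * \<theta> \<psi>"
    using key[of "\<i>/2"] unfolding \<theta>\<eta> by (simp add: norm_divide algebra_simps)
  then have "\<i> * (\<i> * (P - M)) = \<i> * (- 2 * of_real (Im (\<psi> a)) * \<theta> \<psi>)" by simp
  then have "M - P = - (2 * (\<i> * of_real (Im (\<psi> a))) * \<theta> \<psi>)"
    by (simp flip: mult.assoc)
  then have "P - M = 2 * (\<i> * of_real (Im (\<psi> a))) * \<theta> \<psi>"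
    by (metis minus_diff_eq minus_minus)
  ultimately have "2 * P = 2 * ((of_real (Re (\<psi> a)) + \<i> * of_real (Im (\<psi> a))) * \<theta> \<psi>)"
    by (simp add: algebra_simps)
  then show ?thesis by (simp add: P_def \<theta>_def flip: complex_eq)
qed

subsection \<open>Folner families\<close>

lemma sum_div_mod:
  fixes g :: "nat \<Rightarrow> nat \<Rightarrow> 'b::comm_monoid_add"
  shows "(\<Sum>i<N * n. g (i div n) (i mod n)) = (\<Sum>k<N. \<Sum>i<n. g k i)"
proof -
  have "(\<Sum>i<N * n. g (i div n) (i mod n)) = (\<Sum>k<N. \<Sum>i\<in>{k * n..<k * n + n}. g (i div n) (i mod n))"
    by (rule sum.nat_group[symmetric])
  also have "\<dots> = (\<Sum>k<N. \<Sum>i<n. g k i)"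
  proof (rule sum.cong[OF refl])
    fix k
    have "(\<Sum>i\<in>{k * n..<k * n + n}. g (i div n) (i mod n)) = (\<Sum>i\<in>{0..<n}. g ((i + k * n) div n) ((i + k * n) mod n))"
      using sum.shift_bounds_nat_ivl[of "\<lambda>i. g (i div n) (i mod n)" 0 "k * n" n] by (simp add: add.commute)
    also have "\<dots> = (\<Sum>i\<in>{0..<n}. g k i)"
      by (rule sum.cong) auto
    finally show "(\<Sum>i\<in>{k * n..<k * n + n}. g (i div n) (i mod n)) = (\<Sum>i<n. g k i)"
      by (simp add: atLeast0LessThan)
  qed
  finally show ?thesis .
qed

text \<open>A Folner condition for families instead of sets: repetitions are allowed, and near
  invariance is stated directly for sums of bounded functions.\<close>

definition folner_family :: "'a::ab_group_add set \<Rightarrow> real \<Rightarrow> nat \<Rightarrow> (nat \<Rightarrow> 'a) \<Rightarrow> bool" where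
  "folner_family A e n p \<longleftrightarrow> 0 < n \<and> (\<forall>a\<in>A. \<forall>(h :: 'a \<Rightarrow> complex) b. (\<forall>x. cmod (h x) \<le> b) \<longrightarrow>
     cmod ((\<Sum>i<n. h (p i + a)) - (\<Sum>i<n. h (p i))) \<le> e * b * real n)"

lemma folner_familyD:
  assumes "folner_family A e n p" "a \<in> A" "\<And>x. cmod (h x) \<le> b"
  shows "cmod ((\<Sum>i<n. h (p i + a)) - (\<Sum>i<n. h (p i))) \<le> e * b * real n"
  using assms unfolding folner_family_def by blast

text \<open>Induction on \<open>A\<close>. For a new element \<open>a\<close> the family is repeated
  along \<open>N\<close> successive translates by \<open>a\<close>. Shifting by \<open>a\<close>
  telescopes to the two end blocks, an error of proportion \<open>2 / N\<close>, and each block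
  keeps its error for the old elements.\<close>

lemma folner_family_exists:
  fixes A :: "'a::ab_group_add set"
  assumes "finite A" "0 < e"
  shows "\<exists>n p. folner_family A e n p"
  using assms(1)
proof induction
  case empty
  show ?case by (rule exI[of _ 1]) (simp add: folner_family_def)
next
  case (insert a A)
  then obtain n and p :: "nat \<Rightarrow> 'a" where np: "folner_family A e n p" by blast
  then have n: "0 < n" by (simp add: folner_family_def)
  obtain N :: nat where N: "2 / e < real N" using reals_Archimedean2 by blast
  then have "0 < N" using assms(2) by (metis divide_pos_pos gr0I of_nat_0 order_less_asym zero_less_numeral)
  \<comment> \<open>\<open>T k\<close> is translation by the \<open>k\<close>-fold multiple of
    \<open>a\<close>.\<close>
  define T where "T k = ((+) a ^^ k)" for k
  have T_add: "T k x + y = T k (x + y)" for k x y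
    unfolding T_def by (induction k) (auto simp: add.assoc)
  have T_Suc: "T k x + a = T (Suc k) x" for k x
    by (simp add: T_def add.commute)
  define p' where "p' i = T (i div n) (p (i mod n))" for i
  have sum_p': "(\<Sum>i<N * n. h (p' i)) = (\<Sum>k<N. \<Sum>i<n. h (T k (p i)))" for h :: "'a \<Rightarrow> complex"
    unfolding p'_def by (rule sum_div_mod)
  have "cmod ((\<Sum>i<N * n. h (p' i + c)) - (\<Sum>i<N * n. h (p' i))) \<le> e * b * real (N * n)"
    if c: "c \<in> insert a A" and h: "\<forall>x. cmod (h x) \<le> b" for c b and h :: "'a \<Rightarrow> complex"
  proof (cases "c = a")
    case True
    have "(\<Sum>i<N * n. h (p' i + c)) - (\<Sum>i<N * n. h (p' i))
        = (\<Sum>k<N. (\<Sum>i<n. h (T (Suc k) (p i))) - (\<Sum>i<n. h (T k (p i))))"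
      unfolding True sum_p' sum_p'[of "\<lambda>x. h (x + a)"] T_Suc by (simp add: sum_subtractf)
    also have "\<dots> = (\<Sum>i<n. h (T N (p i))) - (\<Sum>i<n. h (T 0 (p i)))"
      by (rule sum_lessThan_telescope)
    also have "cmod \<dots> \<le> cmod (\<Sum>i<n. h (T N (p i))) + cmod (\<Sum>i<n. h (T 0 (p i)))"
      by (rule norm_triangle_ineq4)
    also have "\<dots> \<le> real n * b + real n * b"
      using h by (intro add_mono order_trans[OF sum_norm_bound[of "{..<n}" _ b]]) auto
    also have "\<dots> \<le> e * b * real (N * n)"
    proof -
      have "0 \<le> b" using h norm_ge_zero order_trans by blast
      moreover have "2 \<le> e * real N" using N assms(2) by (simp add: field_simps)
      ultimately have "2 * (b * real n) \<le> e * real N * (b * real n)" by (intro mult_right_mono) auto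
      then show ?thesis by (simp add: algebra_simps)
    qed
    finally show ?thesis .
  next
    case False
    then have "c \<in> A" using c by simp
    have "(\<Sum>i<N * n. h (p' i + c)) - (\<Sum>i<N * n. h (p' i))
        = (\<Sum>k<N. (\<Sum>i<n. h (T k (p i + c))) - (\<Sum>i<n. h (T k (p i))))"
      unfolding sum_p' sum_p'[of "\<lambda>x. h (x + c)"] T_add by (simp add: sum_subtractf)
    also have "cmod \<dots> \<le> real (card {..<N}) * (e * b * real n)"
      using h by (intro sum_norm_bound folner_familyD[OF np \<open>c \<in> A\<close>]) auto
    finally show ?thesis by (simp add: algebra_simps)
  qed
  then have "folner_family (insert a A) e (N * n) p'"
    using n \<open>0 < N\<close> by (simp add: folner_family_def)
  then show ?case by blast
qed

lemma folner_family_translate: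
  assumes "folner_family A e n p"
  shows "folner_family A e n (\<lambda>i. p i + g)"
  unfolding folner_family_def
proof (intro conjI ballI allI impI)
  show "0 < n" using assms by (simp add: folner_family_def)
  fix a b and h :: "'a \<Rightarrow> complex" assume "a \<in> A" "\<forall>x. cmod (h x) \<le> b"
  then show "cmod ((\<Sum>i<n. h (p i + g + a)) - (\<Sum>i<n. h (p i + g))) \<le> e * b * real n"
    using folner_familyD[OF assms, of a "\<lambda>x. h (x + g)" b] by (simp add: ac_simps)
qed

text \<open>Pigeonhole: the sets of indices \<open>i\<close> with \<open>p i - g \<in> B\<close>
  cover all indices as \<open>g\<close> runs through \<open>F\<close>, so one of them has proportion
  at least \<open>1 / card F\<close>. The family translated by that \<open>- g\<close> is
  taken.\<close>

lemma folner_family_dense: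
  fixes A B F :: "'a::ab_group_add set"
  assumes A: "finite A" "0 < e" and F: "finite F" "UNIV \<subseteq> (\<Union>g\<in>F. (+) g ` B)"
  shows "\<exists>n p. folner_family A e n p \<and> real n \<le> real (card F) * real (card {i\<in>{..<n}. p i \<in> B})"
proof -
  obtain n and p :: "nat \<Rightarrow> 'a" where np: "folner_family A e n p" using folner_family_exists[OF A] by blast
  have "{..<n} = (\<Union>g\<in>F. {i\<in>{..<n}. p i + (- g) \<in> B})"
  proof (intro equalityI subsetI)
    fix i assume "i \<in> {..<n}"
    moreover obtain g b where "g \<in> F" "p i = g + b" "b \<in> B" using F(2) by blast
    moreover from this have "p i + (- g) = b" by simp
    ultimately show "i \<in> (\<Union>g\<in>F. {i\<in>{..<n}. p i + (- g) \<in> B})" by blast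
  qed auto
  then have "n \<le> (\<Sum>g\<in>F. card {i\<in>{..<n}. p i + (- g) \<in> B})"
    using card_UN_le[OF F(1), of "\<lambda>g. {i\<in>{..<n}. p i + (- g) \<in> B}"] by (metis card_lessThan)
  moreover have "F \<noteq> {}" using F(2) by auto
  ultimately obtain g where "g \<in> F" "n \<le> card F * card {i\<in>{..<n}. p i + (- g) \<in> B}"
  proof -
    assume *: "\<And>g. g \<in> F \<Longrightarrow> n \<le> card F * card {i\<in>{..<n}. p i + (- g) \<in> B} \<Longrightarrow> thesis"
    show thesis
    proof (rule ccontr)
      assume "\<not> thesis"
      then have less: "card F * card {i\<in>{..<n}. p i + (- g) \<in> B} < n" if "g \<in> F" for g
        using *[OF that] by linarith
      have "card F * (\<Sum>g\<in>F. card {i\<in>{..<n}. p i + (- g) \<in> B}) < (\<Sum>g\<in>F. n)"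
        unfolding sum_distrib_left using F(1) \<open>F \<noteq> {}\<close> less by (intro sum_strict_mono) auto
      then have "card F * (\<Sum>g\<in>F. card {i\<in>{..<n}. p i + (- g) \<in> B}) < card F * n" by simp
      with \<open>n \<le> (\<Sum>g\<in>F. card {i\<in>{..<n}. p i + (- g) \<in> B})\<close> show False by simp
    qed
  qed
  then have "real n \<le> real (card F) * real (card {i\<in>{..<n}. p i + (- g) \<in> B})"
    by (simp only: of_nat_le_iff flip: of_nat_mult)
  then show ?thesis using folner_family_translate[OF np, of "- g"] by fast
qed

subsection \<open>Splitting off a character\<close>

text \<open>At a maximizer \<open>\<psi>\<close> of \<open>q\<close>, the convolution of a translate
  of \<open>\<psi>\<close> with \<open>\<phi>\<close> is \<open>\<psi> a\<close> times
  \<open>\<theta>\<close>. By the Folner property, translating \<open>\<theta>\<close> by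
  \<open>a\<close> then nearly multiplies it by \<open>\<psi> a\<close>. The function
  \<open>v\<close> is a translate of \<open>\<theta>\<close>, scaled so that Cauchy-Schwarz
  dominates its rank one form by that of \<open>\<phi>\<close>.\<close>

lemma approximate_circle_char:
  fixes \<phi> :: "'a::ab_group_add \<Rightarrow> complex"
  assumes \<phi>: "pos_def \<phi>" and s: "0 < s" and e: "0 \<le> e" and np: "folner_family A e n p"
    and dense: "s * real n \<le> (\<Sum>i<n. (cmod (\<phi> (p i)))\<^sup>2)"
  defines "\<delta> \<equiv> s\<^sup>2 / (Re (\<phi> 0)) ^ 3"
  shows "0 < \<delta>"
    and "\<exists>\<psi> v. (\<forall>x. \<psi> (- x) = cnj (\<psi> x)) \<and> \<psi> 0 = 1 \<and> (\<forall>x. cmod (\<psi> x) \<le> 1) \<and> \<delta> \<le> (cmod (v 0))\<^sup>2 \<and>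
      (\<forall>m f (a :: nat \<Rightarrow> 'a). (cmod (\<Sum>k<m. cnj (f k) * v (a k)))\<^sup>2 \<le> Re (pd_form \<phi> {..<m} f a {..<m} f a)) \<and>
      (\<forall>a\<in>A. \<forall>x. cmod (v (x + a) - \<psi> a * v x) \<le> e * (Re (\<phi> 0) / sqrt \<delta>))"
proof -
  let ?I = "{..<n}"
  define c where "c = Re (\<phi> 0)"
  define q where "q \<psi> = Re (pd_form \<phi> ?I (\<lambda>i. \<psi> (p i)) p ?I (\<lambda>i. \<psi> (p i)) p)" for \<psi>
  have n: "0 < n" using np by (simp add: folner_family_def)
  have c_eq: "\<phi> 0 = of_real c" using pos_def_0[OF \<phi>] by (simp add: c_def)
  have c0: "0 \<le> c" using pos_def_0[OF \<phi>] by (simp add: c_def)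
  have "0 < s * real n" using s n by simp
  with dense have "(\<Sum>i<n. (cmod (\<phi> (p i)))\<^sup>2) \<noteq> 0" by linarith
  then obtain i where "cmod (\<phi> (p i)) \<noteq> 0" by (metis (mono_tags, lifting) sum.neutral zero_power2)
  then have c: "0 < c" using pos_def_norm_le[OF \<phi>, of "p i"] unfolding c_def by (smt (verit) norm_ge_zero)
  then show \<delta>: "0 < \<delta>" using s by (simp add: \<delta>_def c_def)
  have "continuous_on UNIV q"
    unfolding q_def pd_form_def by (intro continuous_intros)
  then obtain \<psi> where \<psi>: "pos_def \<psi>" "\<psi> 0 = 1" and max: "\<And>\<psi>'. pos_def \<psi>' \<Longrightarrow> \<psi>' 0 = 1 \<Longrightarrow> q \<psi>' \<le> q \<psi>"
    using pos_def_maximizer_exists by blast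
  define \<theta> where "\<theta> x = (\<Sum>i<n. \<psi> (p i) * \<phi> (x - p i))" for x
  have eigen: "(\<Sum>i<n. \<psi> (p i + a) * \<phi> (x - p i)) = \<psi> a * \<theta> x" for a x
    unfolding \<theta>_def
    by (rule pos_def_maximizer_eigenvector[OF \<phi> _ \<psi>]) (use max in \<open>auto simp: q_def\<close>)
  have \<psi>_le: "cmod (\<psi> x) \<le> 1" for x using pos_def_norm_le[OF \<psi>(1), of x] \<psi>(2) by simp
  \<comment> \<open>The competitor \<open>\<phi>\<close> divided by \<open>c\<close> bounds the
    maximum from below; its value is large by \<open>dense\<close> and Cauchy-Schwarz against a unit
    mass at \<open>0\<close>.\<close>
  have q_ge: "\<delta> * (real n)\<^sup>2 \<le> q \<psi>"
  proof -
    define S where "S = (\<Sum>i<n. (cmod (\<phi> (p i)))\<^sup>2)"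
    have "pd_form \<phi> {0} (\<lambda>_. 1) (\<lambda>x. x) ?I (\<lambda>i. \<phi> (p i)) p = of_real S"
      unfolding pd_form_point S_def of_real_sum complex_norm_square
      by (simp add: pos_def_minus[OF \<phi>])
    then have "(cmod (of_real S))\<^sup>2 \<le> c * q \<phi>"
      using pd_form_Cauchy_Schwarz[OF \<phi>, of "{0}" ?I "\<lambda>_. 1" "\<lambda>x. x" "\<lambda>i. \<phi> (p i)" p]
      unfolding pd_form_point by (simp add: q_def c_def)
    then have "S\<^sup>2 \<le> c * q \<phi>" by simp
    moreover have "(s * real n)\<^sup>2 \<le> S\<^sup>2"
      using dense s unfolding S_def by (intro power_mono) auto
    moreover have "q (\<lambda>x. of_real (1/c) * \<phi> x) \<le> q \<psi>"
      using c c_eq by (intro max pos_def_scale \<phi>) auto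
    moreover have "q (\<lambda>x. of_real (1/c) * \<phi> x) = (1/c)\<^sup>2 * q \<phi>"
      unfolding q_def pd_form_scale_left pd_form_scale_right complex_cnj_complex_of_real
      by (simp only: Re_complex_of_real times_complex.sel Im_complex_of_real) (simp add: power2_eq_square)
    ultimately have "(s * real n)\<^sup>2 \<le> c * q \<phi>" "(1/c)\<^sup>2 * q \<phi> \<le> q \<psi>"
      by linarith+
    moreover from this(2) have "q \<phi> \<le> c\<^sup>2 * q \<psi>" using c by (simp add: field_simps)
    ultimately have "(s * real n)\<^sup>2 \<le> c * (c\<^sup>2 * q \<psi>)"
      using c by (meson mult_le_cancel_left_pos order_trans)
    then show ?thesis
      using c by (simp add: \<delta>_def field_simps power3_eq_cube power2_eq_square flip: c_def)
  qed
  then have q: "0 < q \<psi>" using \<delta> n by (smt (verit) mult_pos_pos of_nat_0_less_iff zero_less_power)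
  \<comment> \<open>\<open>q \<psi>\<close> is the real part of a sum of \<open>n\<close> terms of
    modulus at most \<open>cmod (\<theta> (p i))\<close>, so one of these reaches the
    average.\<close>
  have "\<exists>i<n. q \<psi> \<le> real n * cmod (\<theta> (p i))"
  proof (rule ccontr)
    assume "\<not> ?thesis"
    then have less: "\<And>i. i < n \<Longrightarrow> cmod (\<theta> (p i)) < q \<psi> / real n"
      using n by (auto simp: field_simps not_le)
    have "q \<psi> = Re (\<Sum>i<n. cnj (\<psi> (p i)) * \<theta> (p i))"
      by (simp add: q_def pd_form_def \<theta>_def sum_distrib_left mult.assoc)
    also have "\<dots> \<le> cmod (\<Sum>i<n. cnj (\<psi> (p i)) * \<theta> (p i))" by (rule complex_Re_le_cmod)
    also have "\<dots> \<le> (\<Sum>i<n. cmod (\<theta> (p i)))"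
      using \<psi>_le by (intro sum_norm_le) (simp add: norm_mult mult_left_le_one_le)
    also have "\<dots> < (\<Sum>i<n. q \<psi> / real n)"
      using less n by (intro sum_strict_mono) auto
    finally show False using n by simp
  qed
  then obtain i\<^sub>0 where i\<^sub>0: "q \<psi> \<le> real n * cmod (\<theta> (p i\<^sub>0))" by blast
  define v where "v x = \<theta> (p i\<^sub>0 + x) / of_real (sqrt (q \<psi>))" for x
  have sq: "0 < sqrt (q \<psi>)" using q by simp
  have v0: "\<delta> \<le> (cmod (v 0))\<^sup>2"
  proof -
    have "\<delta> * (real n)\<^sup>2 * q \<psi> \<le> (q \<psi>)\<^sup>2"
      using q_ge q by (simp add: power2_eq_square)
    also have "\<dots> \<le> (real n * cmod (\<theta> (p i\<^sub>0)))\<^sup>2"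
      using i\<^sub>0 q by (intro power_mono) auto
    finally have "(real n)\<^sup>2 * (\<delta> * q \<psi>) \<le> (real n)\<^sup>2 * (cmod (\<theta> (p i\<^sub>0)))\<^sup>2"
      by (simp add: power_mult_distrib algebra_simps)
    then have "\<delta> * q \<psi> \<le> (cmod (\<theta> (p i\<^sub>0)))\<^sup>2"
      using n by (simp add: mult_le_cancel_left_pos)
    then show ?thesis using q by (simp add: v_def norm_divide power_divide field_simps)
  qed
  have v_CS: "(cmod (\<Sum>k<m. cnj (f k) * v (a k)))\<^sup>2 \<le> Re (pd_form \<phi> {..<m} f a {..<m} f a)" for m f and a :: "nat \<Rightarrow> 'a"
  proof -
    define B where "B = pd_form \<phi> {..<m} f (\<lambda>k. p i\<^sub>0 + a k) ?I (\<lambda>i. \<psi> (p i)) p"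
    have "B = (\<Sum>k<m. cnj (f k) * \<theta> (p i\<^sub>0 + a k))"
      by (simp add: B_def pd_form_def \<theta>_def sum_distrib_left mult.assoc)
    then have "(\<Sum>k<m. cnj (f k) * v (a k)) = B / of_real (sqrt (q \<psi>))"
      by (simp add: v_def sum_divide_distrib)
    then have "(cmod (\<Sum>k<m. cnj (f k) * v (a k)))\<^sup>2 = (cmod B)\<^sup>2 / q \<psi>"
      using q by (simp add: norm_divide power_divide)
    moreover have "(cmod B)\<^sup>2 \<le> Re (pd_form \<phi> {..<m} f (\<lambda>k. p i\<^sub>0 + a k) {..<m} f (\<lambda>k. p i\<^sub>0 + a k)) * q \<psi>"
      unfolding B_def q_def by (rule pd_form_Cauchy_Schwarz[OF \<phi>]) auto
    moreover have "pd_form \<phi> {..<m} f (\<lambda>k. p i\<^sub>0 + a k) {..<m} f (\<lambda>k. p i\<^sub>0 + a k) = pd_form \<phi> {..<m} f a {..<m} f a"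
      by (simp add: pd_form_def)
    ultimately have "(cmod (\<Sum>k<m. cnj (f k) * v (a k)))\<^sup>2
        \<le> Re (pd_form \<phi> {..<m} f a {..<m} f a) * q \<psi> / q \<psi>"
      using q by (simp only: divide_right_mono less_imp_le)
    then show ?thesis using q by simp
  qed
  have v_shift: "cmod (v (x + a) - \<psi> a * v x) \<le> e * (c / sqrt \<delta>)" if a: "a \<in> A" for a x
  proof -
    \<comment> \<open>The sums of \<open>h\<close> over the shifted and the unshifted family are the
      two terms to be compared, up to the scaling of \<open>v\<close>.\<close>
    define h where "h y = \<psi> y * \<phi> (p i\<^sub>0 + x + a - y)" for y
    have "cmod (h y) \<le> c" for y
    proof -
      have "cmod (\<psi> y) * cmod (\<phi> (p i\<^sub>0 + x + a - y)) \<le> 1 * c"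
        unfolding c_def by (intro mult_mono \<psi>_le pos_def_norm_le[OF \<phi>]) auto
      then show ?thesis by (simp add: h_def norm_mult)
    qed
    then have "cmod ((\<Sum>i<n. h (p i + a)) - (\<Sum>i<n. h (p i))) \<le> e * c * real n"
      by (rule folner_familyD[OF np a])
    moreover have "(\<Sum>i<n. h (p i)) = \<theta> (p i\<^sub>0 + (x + a))"
      by (simp add: h_def \<theta>_def algebra_simps)
    moreover have "(\<Sum>i<n. h (p i + a)) = \<psi> a * \<theta> (p i\<^sub>0 + x)"
      unfolding eigen[symmetric] by (simp add: h_def algebra_simps)
    moreover have "v (x + a) - \<psi> a * v x = (\<theta> (p i\<^sub>0 + (x + a)) - \<psi> a * \<theta> (p i\<^sub>0 + x)) / of_real (sqrt (q \<psi>))"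
      by (simp add: v_def diff_divide_distrib)
    ultimately have "cmod (v (x + a) - \<psi> a * v x) \<le> e * c * real n / sqrt (q \<psi>)"
      using q by (simp add: norm_divide norm_minus_commute divide_right_mono)
    also have "\<dots> \<le> e * c * real n / (sqrt \<delta> * real n)"
    proof (rule divide_left_mono)
      have "sqrt (\<delta> * (real n)\<^sup>2) \<le> sqrt (q \<psi>)" using q_ge by simp
      then show "sqrt \<delta> * real n \<le> sqrt (q \<psi>)" by (simp add: real_sqrt_mult)
    qed (use e c \<delta> n q in auto)
    finally show ?thesis using n by simp
  qed
  show "\<exists>\<psi> v. (\<forall>x. \<psi> (- x) = cnj (\<psi> x)) \<and> \<psi> 0 = 1 \<and> (\<forall>x. cmod (\<psi> x) \<le> 1) \<and> \<delta> \<le> (cmod (v 0))\<^sup>2 \<and>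
      (\<forall>m f (a :: nat \<Rightarrow> 'a). (cmod (\<Sum>k<m. cnj (f k) * v (a k)))\<^sup>2 \<le> Re (pd_form \<phi> {..<m} f a {..<m} f a)) \<and>
      (\<forall>a\<in>A. \<forall>x. cmod (v (x + a) - \<psi> a * v x) \<le> e * (Re (\<phi> 0) / sqrt \<delta>))"
    using pos_def_minus[OF \<psi>(1)] \<psi>(2) \<psi>_le v0 v_CS v_shift unfolding c_def by blast
qed

text \<open>Letting the Folner families exhaust the group, \<open>\<psi>\<close> and \<open>v\<close> accumulate at a pair with
  \<open>v (x + a) = \<psi> a * v x\<close>, so that the limit of \<open>\<psi>\<close> is a character, and \<open>v\<close> a multiple of it
  whose rank one form is dominated by \<open>\<phi>\<close>.\<close>

lemma pos_def_subtract_circle_char: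
  fixes \<phi> :: "'a::ab_group_add \<Rightarrow> complex"
  assumes \<phi>: "pos_def \<phi>" and s: "0 < s"
    and dense: "\<And>A e. finite A \<Longrightarrow> 0 < e \<Longrightarrow>
      \<exists>n p. folner_family A e n p \<and> s * real n \<le> (\<Sum>i<n. (cmod (\<phi> (p i)))\<^sup>2)"
  defines "\<delta> \<equiv> s\<^sup>2 / (Re (\<phi> 0)) ^ 3"
  shows "0 < \<delta>" "\<exists>\<xi>. circle_char \<xi> \<and> pos_def (\<lambda>x. \<phi> x - of_real \<delta> * \<xi> x)"
proof -
  define c where "c = Re (\<phi> 0)"
  obtain n and p :: "nat \<Rightarrow> 'a" where "folner_family {} 1 n p" "s * real n \<le> (\<Sum>i<n. (cmod (\<phi> (p i)))\<^sup>2)"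
    using dense[of "{}" 1] by auto
  then show \<delta>: "0 < \<delta>"
    unfolding \<delta>_def by (rule approximate_circle_char(1)[OF \<phi> s zero_le_one])
  have c: "0 < c"
  proof (rule ccontr)
    assume "\<not> 0 < c"
    then have "c = 0" using pos_def_0[OF \<phi>] by (simp add: c_def)
    then show False using \<delta> by (simp add: \<delta>_def c_def)
  qed
  \<comment> \<open>\<open>K\<close> collects the closed conditions that hold exactly at every
    stage, \<open>Q (a, e)\<close> the one that holds only up to \<open>e\<close>. By compactness it
    suffices to meet finitely many of the latter at a time.\<close>
  define K where "K = ({\<psi> :: 'a \<Rightarrow> complex. \<forall>x. cmod (\<psi> x) \<le> 1} \<times> {v :: 'a \<Rightarrow> complex. \<forall>x. cmod (v x) \<le> c + 1}) \<inter>
     {(\<psi>, v). (\<forall>x. \<psi> (- x) = cnj (\<psi> x)) \<and> \<psi> 0 = 1 \<and> \<delta> \<le> (cmod (v 0))\<^sup>2 \<and>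
      (\<forall>m f (a :: nat \<Rightarrow> 'a). (cmod (\<Sum>k<m. cnj (f k) * v (a k)))\<^sup>2 \<le> Re (pd_form \<phi> {..<m} f a {..<m} f a))}"
  define Q where "Q = (\<lambda>(a :: 'a, e :: real). {(\<psi>, v). \<forall>x. cmod (v (x + a) - \<psi> a * v x :: complex) \<le> e})"
  have K_compact: "compact K"
    unfolding K_def case_prod_unfold
    by (intro compact_Int_closed compact_Times compact_bounded_functions closed_Collect_conj
        closed_Collect_all closed_Collect_eq closed_Collect_le continuous_intros)
  have Q_closed: "closed (Q z)" for z
    unfolding Q_def case_prod_unfold
    by (intro closed_Collect_all closed_Collect_le continuous_intros)
  have fip: "K \<inter> (\<Inter>z\<in>Z. Q z) \<noteq> {}" if Z: "finite Z" "Z \<subseteq> UNIV \<times> {0<..}" for Z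
  proof -
    define e where "e = Min (insert 1 (snd ` Z))"
    have e: "0 < e" using Z by (auto simp: e_def)
    have e_le: "e \<le> t" if "(a, t) \<in> Z" for a t
      unfolding e_def using Z that by (intro Min_le) (auto intro: rev_image_eqI)
    \<comment> \<open>Chosen so that the error \<open>e' * (Re (\<phi> 0) / sqrt \<delta>)\<close>
      is \<open>e\<close>.\<close>
    define e' where "e' = e * sqrt \<delta> / c"
    have e': "0 < e'" using e \<delta> c by (simp add: e'_def)
    obtain n p where np: "folner_family (fst ` Z) e' n p" "s * real n \<le> (\<Sum>i<n. (cmod (\<phi> (p i)))\<^sup>2)"
      using dense[of "fst ` Z" e'] Z e' by auto
    have ee: "e' * (Re (\<phi> 0) / sqrt \<delta>) = e" using \<delta> c by (simp add: e'_def flip: c_def)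
    obtain \<psi> v where \<psi>v: "\<forall>x. \<psi> (- x) = cnj (\<psi> x)" "\<psi> 0 = 1" "\<forall>x. cmod (\<psi> x) \<le> 1" "\<delta> \<le> (cmod (v 0))\<^sup>2"
      "\<forall>m f (a :: nat \<Rightarrow> 'a). (cmod (\<Sum>k<m. cnj (f k) * v (a k)))\<^sup>2 \<le> Re (pd_form \<phi> {..<m} f a {..<m} f a)"
      "\<forall>a\<in>fst ` Z. \<forall>x. cmod (v (x + a) - \<psi> a * v x) \<le> e"
      using approximate_circle_char(2)[OF \<phi> s less_imp_le[OF e'] np] unfolding \<delta>_def[symmetric] ee by blast
    have "cmod (v x) \<le> c + 1" for x
    proof -
      have "(cmod (v x))\<^sup>2 \<le> c"
        using \<psi>v(5)[THEN spec[of _ 1], THEN spec[of _ "\<lambda>_. 1"], THEN spec[of _ "\<lambda>_. x"]] by (simp add: pd_form_def c_def)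
      also have "c \<le> (c + 1)\<^sup>2" using c by (simp add: power2_eq_square algebra_simps)
      finally show ?thesis using c power2_le_imp_le by fastforce
    qed
    then have "(\<psi>, v) \<in> K" using \<psi>v by (simp add: K_def)
    moreover have "(\<psi>, v) \<in> Q z" if "z \<in> Z" for z
    proof -
      obtain a t where z: "z = (a, t)" by fastforce
      then have "a \<in> fst ` Z" using that by force
      then have "cmod (v (x + a) - \<psi> a * v x) \<le> t" for x
        using \<psi>v(6) e_le[of a t] that z order_trans by blast
      then show ?thesis by (simp add: Q_def z)
    qed
    ultimately show ?thesis by blast
  qed
  have "K \<inter> (\<Inter>z\<in>UNIV \<times> {0<..}. Q z) \<noteq> {}"
    by (rule compact_imp_fip_image[OF K_compact Q_closed fip])
  then obtain \<psi> v where K: "(\<psi>, v) \<in> K" and Q: "\<And>a e. 0 < e \<Longrightarrow> (\<psi>, v) \<in> Q (a, e)" by fastforce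
  have v_add: "v (x + a) = \<psi> a * v x" for x a
  proof -
    have "cmod (v (x + a) - \<psi> a * v x) \<le> 0 + e" if "0 < e" for e
      using Q[OF that, of a] by (simp add: Q_def)
    then have "cmod (v (x + a) - \<psi> a * v x) \<le> 0" by (rule field_le_epsilon)
    then show ?thesis by simp
  qed
  have \<psi>: "\<psi> (- x) = cnj (\<psi> x)" "\<psi> 0 = 1" for x using K by (auto simp: K_def)
  have v0: "\<delta> \<le> (cmod (v 0))\<^sup>2" using K by (auto simp: K_def)
  have v: "v x = \<psi> x * v 0" for x using v_add[of 0 x] by simp
  have "v 0 \<noteq> 0" using v0 \<delta> by auto
  then have mult: "\<psi> (x + y) = \<psi> x * \<psi> y" for x y
    using v_add[of x y] unfolding v[of "x + y"] v[of x] by (simp add: mult.commute)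
  have "cmod (\<psi> x) = 1" for x
  proof -
    have "\<psi> x * cnj (\<psi> x) = 1" using mult[of x "- x"] \<psi> by simp
    then have "(cmod (\<psi> x))\<^sup>2 = 1" by (metis complex_norm_square of_real_eq_1_iff)
    then show ?thesis by (simp add: power2_eq_1_iff) (metis norm_ge_zero not_one_le_zero neg_0_le_iff_le)
  qed
  then have char: "circle_char \<psi>" using mult by (simp add: circle_char_def)
  have "pos_def (\<lambda>x. \<phi> x - of_real \<delta> * \<psi> x)"
    unfolding pos_def_def
  proof (intro conjI allI)
    show "\<phi> (- x) - of_real \<delta> * \<psi> (- x) = cnj (\<phi> x - of_real \<delta> * \<psi> x)" for x
      by (simp add: \<psi> pos_def_minus[OF \<phi>])
    fix n :: nat and f :: "nat \<Rightarrow> complex" and a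
    define S where "S = (\<Sum>i<n. f i * cnj (\<psi> (a i)))"
    have "(\<Sum>k<n. cnj (f k) * v (a k)) = cnj S * v 0"
      by (simp add: S_def v[of "a _"] sum_distrib_right mult.assoc)
    moreover have "(cmod (\<Sum>k<n. cnj (f k) * v (a k)))\<^sup>2 \<le> Re (pd_form \<phi> {..<n} f a {..<n} f a)"
      using K by (auto simp: K_def)
    ultimately have "(cmod S)\<^sup>2 * (cmod (v 0))\<^sup>2 \<le> Re (pd_form \<phi> {..<n} f a {..<n} f a)"
      by (simp add: norm_mult power_mult_distrib)
    moreover have "(cmod S)\<^sup>2 * \<delta> \<le> (cmod S)\<^sup>2 * (cmod (v 0))\<^sup>2"
      using v0 by (intro mult_left_mono) auto
    moreover have "pd_form \<psi> {..<n} f a {..<n} f a = of_real ((cmod S)\<^sup>2)"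
      unfolding pd_form_circle_char[OF char] S_def[symmetric] complex_norm_square by (rule mult.commute)
    ultimately show "0 \<le> Re (pd_form (\<lambda>x. \<phi> x - of_real \<delta> * \<psi> x) {..<n} f a {..<n} f a)"
      by (simp add: pd_form_diff pd_form_mult mult.commute del: of_real_power)
  qed
  with char show "\<exists>\<xi>. circle_char \<xi> \<and> pos_def (\<lambda>x. \<phi> x - of_real \<delta> * \<xi> x)" by blast
qed

section \<open>Finite sums of characters approximating a positive definite function\<close>

lemma nbhd_zero_mono: "nbhd_zero T U \<Longrightarrow> U \<subseteq> W \<Longrightarrow> nbhd_zero T W"
  unfolding nbhd_zero_def by blast

lemma tb_group_topology_cover:
  assumes "tb_group_topology T" "nbhd_zero T U"
  obtains F where "finite F" "UNIV \<subseteq> (\<Union>g\<in>F. (+) g ` U)"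
  using assms unfolding tb_group_topology_def by blast

lemma Re_circle_char_le: "circle_char \<xi> \<Longrightarrow> Re (\<xi> x) \<le> 1"
  by (metis circle_char_norm complex_Re_le_cmod)

lemma pos_def_add: "pos_def \<phi> \<Longrightarrow> pos_def \<psi> \<Longrightarrow> pos_def (\<lambda>x. \<phi> x + \<psi> x)"
  unfolding pos_def_def pd_form_add by simp

text \<open>Characters are split off greedily, each with the same weight \<open>\<delta>\<close>; a remainder \<open>\<rho>\<close> from
  which no further one can be taken has \<open>\<rho> 0 < e\<close>, because its modulus is at least \<open>e / 2\<close> on a
  neighbourhood of zero, hence on a set of positive density.\<close>

lemma pos_def_character_decomposition:
  fixes T :: "'a::ab_group_add topology"
  assumes T: "tb_group_topology T" and \<phi>: "pos_def \<phi>"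
    and cont: "\<And>e. 0 < e \<Longrightarrow> nbhd_zero T {x. Re (\<phi> 0) - Re (\<phi> x) \<le> e}"
    and e: "0 < e" "e \<le> Re (\<phi> 0)"
  shows "\<exists>\<delta>>0. \<exists>Xs. (\<forall>\<xi>\<in>set Xs. circle_char \<xi>) \<and> (\<forall>x. 0 \<le> (\<Sum>\<xi>\<leftarrow>Xs. 1 - Re (\<xi> x))) \<and>
    (\<forall>x. \<delta> * (\<Sum>\<xi>\<leftarrow>Xs. 1 - Re (\<xi> x)) \<le> Re (\<phi> 0) - Re (\<phi> x)) \<and>
    (\<forall>x. Re (\<phi> 0) - Re (\<phi> x) \<le> \<delta> * (\<Sum>\<xi>\<leftarrow>Xs. 1 - Re (\<xi> x)) + 2 * e)"
proof -
  define c where "c = Re (\<phi> 0)"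
  have c: "0 < c" using e by (simp add: c_def)
  define B where "B = {x. Re (\<phi> 0) - Re (\<phi> x) \<le> e / 2}"
  obtain F where F: "finite F" "UNIV \<subseteq> (\<Union>g\<in>F. (+) g ` B)"
    using tb_group_topology_cover[OF T cont[of "e/2"]] e unfolding B_def by auto
  have "F \<noteq> {}" using F(2) by auto
  then have cF: "0 < real (card F)" using F(1) by (simp add: card_gt_0_iff)
  \<comment> \<open>On a proportion \<open>1 / card F\<close> of a suitable Folner family the
    remainder will have modulus at least \<open>e / 2\<close>.\<close>
  define s where "s = (e/2)\<^sup>2 / real (card F)"
  have s: "0 < s" using e cF by (simp add: s_def)
  \<comment> \<open>The weight is computed with \<open>c\<close>, an upper bound for the value of
    each remainder at \<open>0\<close>, so the same weight serves at every stage.\<close>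
  define \<delta> where "\<delta> = s\<^sup>2 / c ^ 3"
  have \<delta>: "0 < \<delta>" using s c by (simp add: \<delta>_def)
  define \<rho> where "\<rho> Xs x = \<phi> x - of_real \<delta> * (\<Sum>\<xi>\<leftarrow>Xs. \<xi> x)" for Xs x
  define P where "P Xs \<longleftrightarrow> (\<forall>\<xi>\<in>set Xs. circle_char \<xi>) \<and> pos_def (\<rho> Xs)" for Xs
  have \<rho>_0: "\<rho> Xs 0 = of_real (c - \<delta> * real (length Xs))" if "\<forall>\<xi>\<in>set Xs. circle_char \<xi>" for Xs
  proof -
    have "(\<Sum>\<xi>\<leftarrow>Xs. \<xi> 0) = of_nat (length Xs)"
      using that by (induction Xs) (auto simp: circle_char_0)
    then show ?thesis using pos_def_0[OF \<phi>] by (simp add: \<rho>_def c_def)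
  qed
  have Re_\<rho>: "Re (\<rho> Xs 0) - Re (\<rho> Xs x) = (c - Re (\<phi> x)) - \<delta> * (\<Sum>\<xi>\<leftarrow>Xs. 1 - Re (\<xi> x))"
    if "\<forall>\<xi>\<in>set Xs. circle_char \<xi>" for Xs x
  proof -
    have *: "(\<Sum>\<xi>\<leftarrow>Xs. 1 - Re (\<xi> x)) = real (length Xs) - Re (\<Sum>\<xi>\<leftarrow>Xs. \<xi> x)"
      by (induction Xs) auto
    show ?thesis unfolding \<rho>_0[OF that] * by (simp add: \<rho>_def algebra_simps)
  qed
  have nonneg: "0 \<le> (\<Sum>\<xi>\<leftarrow>Xs. 1 - Re (\<xi> x))" if "\<forall>\<xi>\<in>set Xs. circle_char \<xi>" for Xs x
    using that by (intro sum_list_nonneg) (auto simp: Re_circle_char_le)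
  have bound: "length Xs \<le> nat \<lfloor>c / \<delta>\<rfloor>" if "P Xs" for Xs
  proof -
    have "0 \<le> c - \<delta> * real (length Xs)"
      using pos_def_0(2)[of "\<rho> Xs"] that \<rho>_0[of Xs] by (simp add: P_def)
    then have "real (length Xs) \<le> c / \<delta>" using \<delta> by (simp add: field_simps)
    then show ?thesis by (simp add: le_nat_floor)
  qed
  have "\<rho> [] = \<phi>" by (simp add: \<rho>_def fun_eq_iff)
  then have "P []" using \<phi> by (simp add: P_def)
  \<comment> \<open>Each character lowers the value at \<open>0\<close> by \<open>\<delta>\<close>,
    so the lengths are bounded and a longest list exists.\<close>
  then obtain Xs where Xs: "P Xs" and max: "\<And>Ys. P Ys \<Longrightarrow> length Ys \<le> length Xs"
    using ex_has_greatest_nat[of P "[]" length "Suc (nat \<lfloor>c / \<delta>\<rfloor>)"] bound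
    by (metis le_imp_less_Suc)
  have chars: "\<forall>\<xi>\<in>set Xs. circle_char \<xi>" and pd: "pos_def (\<rho> Xs)" using Xs by (auto simp: P_def)
  have small: "Re (\<rho> Xs 0) < e"
  proof (rule ccontr)
    assume "\<not> ?thesis"
    then have big: "e \<le> Re (\<rho> Xs 0)" by simp
    have B: "e / 2 \<le> cmod (\<rho> Xs x)" if "x \<in> B" for x
    proof -
      have "0 \<le> \<delta> * (\<Sum>\<xi>\<leftarrow>Xs. 1 - Re (\<xi> x))" using \<delta> nonneg[OF chars] by simp
      moreover have "c - Re (\<phi> x) \<le> e / 2" using that by (simp add: B_def c_def)
      ultimately have "Re (\<rho> Xs 0) - Re (\<rho> Xs x) \<le> e / 2"
        unfolding Re_\<rho>[OF chars] by linarith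
      then show ?thesis using big complex_Re_le_cmod[of "\<rho> Xs x"] by linarith
    qed
    have "\<exists>n p. folner_family A e' n p \<and> s * real n \<le> (\<Sum>i<n. (cmod (\<rho> Xs (p i)))\<^sup>2)"
      if A: "finite A" "0 < e'" for A :: "'a set" and e'
    proof -
      obtain n p where np: "folner_family A e' n p" and n: "real n \<le> real (card F) * real (card {i\<in>{..<n}. p i \<in> B})"
        using folner_family_dense[OF A F] by blast
      have "s * real n \<le> s * (real (card F) * real (card {i\<in>{..<n}. p i \<in> B}))"
        using n s by (intro mult_left_mono) auto
      also have "\<dots> = (\<Sum>i\<in>{i\<in>{..<n}. p i \<in> B}. (e/2)\<^sup>2)" using cF by (simp add: s_def)
      also have "\<dots> \<le> (\<Sum>i\<in>{i\<in>{..<n}. p i \<in> B}. (cmod (\<rho> Xs (p i)))\<^sup>2)"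
        using B e by (intro sum_mono power_mono) auto
      also have "\<dots> \<le> (\<Sum>i<n. (cmod (\<rho> Xs (p i)))\<^sup>2)"
        by (intro sum_mono2) auto
      finally show ?thesis using np by blast
    qed
    from pos_def_subtract_circle_char(2)[OF pd s this] obtain \<xi> where \<xi>: "circle_char \<xi>"
      and pd': "pos_def (\<lambda>x. \<rho> Xs x - of_real (s\<^sup>2 / (Re (\<rho> Xs 0)) ^ 3) * \<xi> x)"
      by blast
    have "Re (\<rho> Xs 0) \<le> c" using \<rho>_0[OF chars] \<delta> by simp
    then have "\<delta> \<le> s\<^sup>2 / (Re (\<rho> Xs 0)) ^ 3"
      unfolding \<delta>_def using big e c by (intro divide_left_mono power_mono) auto
    \<comment> \<open>The weight that can be split off may exceed \<open>\<delta>\<close>; the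
      surplus is given back to the remainder as a nonnegative multiple of
      \<open>\<xi>\<close>.\<close>
    then have "pos_def (\<lambda>x. of_real (s\<^sup>2 / (Re (\<rho> Xs 0)) ^ 3 - \<delta>) * \<xi> x)"
      by (intro pos_def_scale pos_def_circle_char \<xi>) auto
    moreover have "\<rho> (\<xi> # Xs) = (\<lambda>x. (\<rho> Xs x - of_real (s\<^sup>2 / (Re (\<rho> Xs 0)) ^ 3) * \<xi> x)
        + of_real (s\<^sup>2 / (Re (\<rho> Xs 0)) ^ 3 - \<delta>) * \<xi> x)"
      unfolding \<rho>_def by (simp add: fun_eq_iff algebra_simps)
    ultimately have "pos_def (\<rho> (\<xi> # Xs))" using pos_def_add[OF pd'] by simp
    then have "P (\<xi> # Xs)" using \<xi> chars by (simp add: P_def)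
    from max[OF this] show False by simp
  qed
  have lower: "0 \<le> Re (\<rho> Xs 0) - Re (\<rho> Xs x)" and upper: "Re (\<rho> Xs 0) - Re (\<rho> Xs x) \<le> 2 * e" for x
  proof -
    have "\<bar>Re (\<rho> Xs x)\<bar> \<le> Re (\<rho> Xs 0)"
      using abs_Re_le_cmod pos_def_norm_le[OF pd] order_trans by blast
    then show "0 \<le> Re (\<rho> Xs 0) - Re (\<rho> Xs x)" "Re (\<rho> Xs 0) - Re (\<rho> Xs x) \<le> 2 * e" using small by auto
  qed
  show ?thesis
    using \<delta> chars nonneg[OF chars] lower upper unfolding Re_\<rho>[OF chars] c_def
    by (intro exI[of _ \<delta>] conjI exI[of _ Xs] allI) (auto simp: algebra_simps)
qed

text \<open>In the decomposition of \<open>\<phi>\<close>, the bound of the character sum by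
  \<open>\<phi>\<close> makes each character continuous at zero. By the reverse bound,
  \<open>\<phi>\<close> cannot drop from \<open>c\<close> to \<open>0\<close> where all these
  characters are near 1.\<close>

lemma pos_def_controls_circle_chars:
  fixes T :: "'a::ab_group_add topology"
  assumes T: "tb_group_topology T" and \<phi>: "pos_def \<phi>"
    and cont: "\<And>e. 0 < e \<Longrightarrow> nbhd_zero T {x. Re (\<phi> 0) - Re (\<phi> x) \<le> e}"
    and pos: "0 < Re (\<phi> 0)" and U: "\<And>x. \<phi> x \<noteq> 0 \<Longrightarrow> x \<in> U"
  shows "\<exists>X e. finite X \<and> 0 < e \<and>
    (\<forall>\<xi>\<in>X. circle_char \<xi> \<and> (\<forall>r>0. nbhd_zero T {x. 1 - Re (\<xi> x) < r})) \<and>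
    {x. \<forall>\<xi>\<in>X. 1 - Re (\<xi> x) < e} \<subseteq> U"
proof -
  define c where "c = Re (\<phi> 0)"
  have c: "0 < c" using pos by (simp add: c_def)
  obtain \<delta> Xs where \<delta>: "0 < \<delta>" and Xs: "\<forall>\<xi>\<in>set Xs. circle_char \<xi>"
    and up: "\<And>x. \<delta> * (\<Sum>\<xi>\<leftarrow>Xs. 1 - Re (\<xi> x)) \<le> c - Re (\<phi> x)"
    and low: "\<And>x. c - Re (\<phi> x) \<le> \<delta> * (\<Sum>\<xi>\<leftarrow>Xs. 1 - Re (\<xi> x)) + 2 * (c / 4)"
    using pos_def_character_decomposition[OF T \<phi> cont, of "c / 4"] c unfolding c_def by fastforce
  \<comment> \<open>Keeps \<open>\<delta>\<close> times the character sum below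
    \<open>c / 2\<close>; the added 1 covers the empty list.\<close>
  define e where "e = c / (2 * \<delta> * (real (length Xs) + 1))"
  have len: "0 < real (length Xs) + 1" by linarith
  then have e: "0 < e" using c \<delta> by (simp add: e_def)
  have small: "nbhd_zero T {x. 1 - Re (\<xi> x) < r}" if \<xi>: "\<xi> \<in> set Xs" and r: "0 < r" for \<xi> r
  proof (rule nbhd_zero_mono[OF cont])
    show "0 < \<delta> * r / 2" using \<delta> r by simp
    show "{x. Re (\<phi> 0) - Re (\<phi> x) \<le> \<delta> * r / 2} \<subseteq> {x. 1 - Re (\<xi> x) < r}"
    proof clarify
      fix x assume x: "Re (\<phi> 0) - Re (\<phi> x) \<le> \<delta> * r / 2"
      have "1 - Re (\<xi> x) \<le> (\<Sum>\<xi>\<leftarrow>Xs. 1 - Re (\<xi> x))"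
        using \<xi> Xs by (intro member_le_sum_list) (auto simp: Re_circle_char_le)
      then have "\<delta> * (1 - Re (\<xi> x)) \<le> \<delta> * (\<Sum>\<xi>\<leftarrow>Xs. 1 - Re (\<xi> x))" using \<delta> by simp
      also have "\<dots> \<le> \<delta> * (r / 2)" using up[of x] x by (simp add: c_def)
      finally have "1 - Re (\<xi> x) \<le> r / 2" using \<delta> by (simp add: mult_le_cancel_left_pos)
      then show "1 - Re (\<xi> x) < r" using r by simp
    qed
  qed
  have "\<phi> x \<noteq> 0" if x: "\<forall>\<xi>\<in>set Xs. 1 - Re (\<xi> x) < e" for x
  proof
    assume "\<phi> x = 0"
    then have "c / 2 \<le> \<delta> * (\<Sum>\<xi>\<leftarrow>Xs. 1 - Re (\<xi> x))" using low[of x] by simp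
    moreover have "(\<Sum>\<xi>\<leftarrow>Xs. 1 - Re (\<xi> x)) \<le> (\<Sum>\<xi>\<leftarrow>Xs. e)"
      using x by (intro sum_list_mono) auto
    then have "\<delta> * (\<Sum>\<xi>\<leftarrow>Xs. 1 - Re (\<xi> x)) \<le> \<delta> * (real (length Xs) * e)"
      using \<delta> by (simp add: sum_list_triv)
    moreover have "\<delta> * (real (length Xs) * e) < \<delta> * ((real (length Xs) + 1) * e)"
      using \<delta> e by simp
    moreover have "\<delta> * ((real (length Xs) + 1) * e) = c / 2"
      using \<delta> len by (simp add: e_def)
    ultimately show False by linarith
  qed
  then show ?thesis using Xs small e U
    by (intro exI[of _ "set Xs"] exI[of _ e]) auto
qed

subsection \<open>Bump functions\<close>

primrec dyadic_sum :: "(nat \<Rightarrow> 'a::ab_group_add set) \<Rightarrow> nat \<Rightarrow> nat \<Rightarrow> 'a set" where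
  "dyadic_sum V 0 k = (if k = 0 then {0} else if k = 1 then V 0 else UNIV)"
| "dyadic_sum V (Suc n) k = (if even k then dyadic_sum V n (k div 2)
     else {x + v |x v. x \<in> dyadic_sum V n (k div 2) \<and> v \<in> V (Suc n)})"

text \<open>The set \<open>dyadic_sum V n k\<close> is the sum of the \<open>V i\<close> over the binary digits of \<open>k / 2 ^ n\<close>.
  The following is the carry of an addition in binary.\<close>

lemma dyadic_sum_add:
  assumes V: "\<And>n x y. x \<in> V (Suc n) \<Longrightarrow> y \<in> V (Suc n) \<Longrightarrow> x + y \<in> V n"
  shows "x \<in> dyadic_sum V n k \<Longrightarrow> v \<in> V n \<Longrightarrow> x + v \<in> dyadic_sum V n (Suc k)"
proof (induction n arbitrary: k x v)
  case 0
  then show ?case by (auto split: if_splits)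
next
  case (Suc n)
  show ?case
  proof (cases "even k")
    case True
    then show ?thesis using Suc.prems by auto
  next
    case False
    then obtain y w where y: "x = y + w" "y \<in> dyadic_sum V n (k div 2)" "w \<in> V (Suc n)"
      using Suc.prems by auto
    then have "y + (w + v) \<in> dyadic_sum V n (Suc (k div 2))"
      using Suc.prems V by (intro Suc.IH) auto
    moreover have "Suc k div 2 = Suc (k div 2)" using False by presburger
    ultimately show ?thesis using False y by (simp add: add.assoc)
  qed
qed

lemma dyadic_sum_mono:
  assumes V: "\<And>n x y. x \<in> V (Suc n) \<Longrightarrow> y \<in> V (Suc n) \<Longrightarrow> x + y \<in> V n" and V0: "\<And>n. 0 \<in> V n"
    and "k \<le> l"
  shows "dyadic_sum V n k \<subseteq> dyadic_sum V n l"
  using \<open>k \<le> l\<close>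
proof (induction rule: dec_induct)
  case (step m)
  then show ?case using dyadic_sum_add[of V _ n m 0, OF V _ V0] by auto
qed auto

lemma dyadic_sum_refine: "dyadic_sum V (n + m) (k * 2 ^ m) = dyadic_sum V n k"
  by (induction m) auto

text \<open>The Birkhoff--Kakutani construction.\<close>

lemma uniformly_continuous_separation:
  fixes V :: "nat \<Rightarrow> 'a::ab_group_add set"
  assumes V: "\<And>n x y. x \<in> V (Suc n) \<Longrightarrow> y \<in> V (Suc n) \<Longrightarrow> x + y \<in> V n" and V0: "\<And>n. 0 \<in> V n"
  obtains f :: "'a \<Rightarrow> real" where "f 0 = 0" "\<And>x. 0 \<le> f x" "\<And>x. x \<notin> V 0 \<Longrightarrow> 1 \<le> f x"
    "\<And>n x v. v \<in> V n \<Longrightarrow> f (x + v) \<le> f x + 2 / 2 ^ n"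
proof -
  define D where "D x = {real k / 2 ^ n |k n. x \<in> dyadic_sum V n k}" for x
  define f where "f x = Inf (D x)" for x
  \<comment> \<open>\<open>dyadic_sum V 0 2\<close> is \<open>UNIV\<close>, so the number 2 lies in
    every \<open>D x\<close>.\<close>
  have ne: "D x \<noteq> {}" for x
  proof -
    have "x \<in> dyadic_sum V 0 2" by simp
    then show ?thesis unfolding D_def by blast
  qed
  have bdd: "bdd_below (D x)" for x by (rule bdd_belowI[of _ 0]) (auto simp: D_def)
  have f_le: "f x \<le> real k / 2 ^ n" if "x \<in> dyadic_sum V n k" for x n k
    unfolding f_def using that by (intro cInf_lower bdd) (auto simp: D_def)
  have f_ge: "b \<le> f x" if "\<And>k n. x \<in> dyadic_sum V n k \<Longrightarrow> b \<le> real k / 2 ^ n" for b x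
    unfolding f_def using that by (intro cInf_greatest ne) (auto simp: D_def)
  show ?thesis
  proof
    show nonneg: "0 \<le> f x" for x by (rule f_ge) simp
    show "f 0 = 0" using f_le[of 0 0 0] nonneg[of 0] by simp
    show "1 \<le> f x" if x: "x \<notin> V 0" for x
    proof (rule f_ge)
      fix k n assume k: "x \<in> dyadic_sum V n k"
      have "dyadic_sum V n (2 ^ n) = V 0"
        using dyadic_sum_refine[of V 0 n 1] by simp
      then have "\<not> k \<le> 2 ^ n"
        using x k dyadic_sum_mono[of V k "2 ^ n" n, OF V V0] by blast
      then have "2 ^ n \<le> k" by simp
      then have "2 ^ n \<le> real k" by (metis of_nat_le_iff of_nat_numeral of_nat_power)
      then show "1 \<le> real k / 2 ^ n" by simp
    qed
    show "f (x + v) \<le> f x + 2 / 2 ^ n" if v: "v \<in> V n" for n x v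
    proof -
      have "f (x + v) - 2 / 2 ^ n \<le> f x"
      proof (rule f_ge)
        fix k m assume k: "x \<in> dyadic_sum V m k"
        define l where "l = k * 2 ^ n"
        \<comment> \<open>\<open>j / 2 ^ n\<close> is \<open>k / 2 ^ m\<close> rounded up at a cost
          of at most \<open>1 / 2 ^ n\<close>; adding \<open>v\<close> costs another such
          unit.\<close>
        define j where "j = Suc (l div 2 ^ m)"
        have "x \<in> dyadic_sum V (n + m) l"
          using k dyadic_sum_refine[of V m n k] by (simp add: l_def add.commute)
        moreover have "l \<le> j * 2 ^ m"
          unfolding j_def using dividend_less_div_times[of "2 ^ m" l] by simp
        ultimately have "x \<in> dyadic_sum V (n + m) (j * 2 ^ m)"
          using dyadic_sum_mono[of V l "j * 2 ^ m" "n + m", OF V V0] by blast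
        then have "x \<in> dyadic_sum V n j" by (simp add: dyadic_sum_refine)
        then have "x + v \<in> dyadic_sum V n (Suc j)" using dyadic_sum_add[of V x n j v, OF V] v by blast
        then have "f (x + v) \<le> real (Suc j) / 2 ^ n" by (rule f_le)
        also have "real (Suc j) = real (l div 2 ^ m) + 2" by (simp add: j_def)
        also have "real (l div 2 ^ m) \<le> real l / 2 ^ m"
          using of_nat_div_le_of_nat[of l "2 ^ m", where 'a = real] by simp
        also have "(real l / 2 ^ m + 2) / 2 ^ n = real k / 2 ^ m + 2 / 2 ^ n"
          by (simp add: l_def add_divide_distrib)
        finally show "f (x + v) - 2 / 2 ^ n \<le> real k / 2 ^ m" by (simp add: divide_right_mono)
      qed
      then show ?thesis by simp
    qed
  qed
qed

section \<open>Bumps in a topological group and their autocorrelation\<close>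

lemma group_topology_add: 
  assumes T: "group_topology T" and U: "nbhd_zero T U"
  obtains W where "nbhd_zero T W" "\<And>x y. x \<in> W \<Longrightarrow> y \<in> W \<Longrightarrow> x + y \<in> U" "\<And>x. x \<in> W \<Longrightarrow> - x \<in> W"
proof -
  obtain U' where U': "openin T U'" "0 \<in> U'" "U' \<subseteq> U" using U by (auto simp: nbhd_zero_def)
  have top: "topspace T = UNIV" and add: "continuous_map (prod_topology T T) T (\<lambda>(x, y). x + y)"
    and minus: "continuous_map T T uminus"
    using T by (auto simp: group_topology_def)
  define S where "S = {z. (\<lambda>(x, y). x + y) z \<in> U'}"
  have S: "openin (prod_topology T T) S"
    using openin_continuous_map_preimage[OF add U'(1)] top by (simp add: S_def)
  have "(0, 0) \<in> S" using U' by (simp add: S_def)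
  from iffD1[OF openin_prod_topology_alt S, rule_format, OF this] obtain A B where AB: "openin T A" "openin T B" "0 \<in> A" "0 \<in> B" "A \<times> B \<subseteq> S"
    by blast
  define C where "C = A \<inter> B"
  have C: "openin T C" "0 \<in> C" using AB by (auto simp: C_def)
  have C': "openin T {x. - x \<in> C}"
    using openin_continuous_map_preimage[OF minus C(1)] top by simp
  define W where "W = C \<inter> {x. - x \<in> C}"
  have "openin T W" "0 \<in> W" using C C' by (auto simp: W_def)
  then have "nbhd_zero T W" by (auto simp: nbhd_zero_def)
  moreover have "x + y \<in> U" if "x \<in> W" "y \<in> W" for x y
    using that AB(5) U'(3) unfolding W_def C_def S_def by auto
  moreover have "- x \<in> W" if "x \<in> W" for x using that by (auto simp: W_def)
  ultimately show ?thesis using that by blast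
qed

lemma nbhd_zero_0: "nbhd_zero T U \<Longrightarrow> 0 \<in> U"
  unfolding nbhd_zero_def by blast

text \<open>Symmetric neighbourhoods, each containing the sum of the next with itself, give a
  separating function \<open>f\<close>, and \<open>1 - f\<close> is cut off at \<open>0\<close>.
  Symmetry turns the one-sided estimate for \<open>f\<close> into a two-sided one.\<close>

lemma group_topology_bump:
  assumes T: "group_topology T" and U: "nbhd_zero T U"
  shows "\<exists>g :: 'a::ab_group_add \<Rightarrow> real. g 0 = 1 \<and> (\<forall>x. 0 \<le> g x) \<and> (\<forall>x. g x \<le> 1) \<and> (\<forall>x. x \<notin> U \<longrightarrow> g x = 0) \<and>
    (\<forall>e>0. nbhd_zero T {v. \<forall>x. \<bar>g (x + v) - g x\<bar> \<le> e})"
proof -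
  let ?P = "\<lambda>_ W. nbhd_zero T W \<and> (\<forall>x\<in>W. - x \<in> W)"
  let ?Q = "\<lambda>_ W W'. \<forall>x\<in>W'. \<forall>y\<in>W'. x + y \<in> W"
  obtain W\<^sub>0 where W0: "nbhd_zero T W\<^sub>0" "\<And>x. x \<in> W\<^sub>0 \<Longrightarrow> - x \<in> W\<^sub>0" "\<And>x y. x \<in> W\<^sub>0 \<Longrightarrow> y \<in> W\<^sub>0 \<Longrightarrow> x + y \<in> U"
    using group_topology_add[OF T U] by metis
  then have "W\<^sub>0 \<subseteq> U" using nbhd_zero_0 by fastforce
  have "\<exists>V. (\<forall>n. ?P n (V n) \<and> V 0 = W\<^sub>0) \<and> (\<forall>n. ?Q n (V n) (V (Suc n)))"
  proof -
    have "\<exists>V. \<forall>n. (?P n (V n) \<and> (n = 0 \<longrightarrow> V n = W\<^sub>0)) \<and> ?Q n (V n) (V (Suc n))"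
    proof (rule dependent_nat_choice)
      show "\<exists>W. ?P 0 W \<and> (0 = (0::nat) \<longrightarrow> W = W\<^sub>0)" using W0 by blast
      fix W and n :: nat assume "?P n W \<and> (n = 0 \<longrightarrow> W = W\<^sub>0)"
      then obtain W' where "nbhd_zero T W'" "\<And>x. x \<in> W' \<Longrightarrow> - x \<in> W'" "\<And>x y. x \<in> W' \<Longrightarrow> y \<in> W' \<Longrightarrow> x + y \<in> W"
        using group_topology_add[OF T, of W] by metis
      then show "\<exists>W'. (?P (Suc n) W' \<and> (Suc n = 0 \<longrightarrow> W' = W\<^sub>0)) \<and> ?Q n W W'" by blast
    qed
    then show ?thesis by metis
  qed
  then obtain V where "(\<forall>n. ?P n (V n) \<and> V 0 = W\<^sub>0) \<and> (\<forall>n. ?Q n (V n) (V (Suc n)))" by (elim exE)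
  then have V: "\<And>n. nbhd_zero T (V n)" "\<And>n x. x \<in> V n \<Longrightarrow> - x \<in> V n" "V 0 = W\<^sub>0"
    "\<And>n x y. x \<in> V (Suc n) \<Longrightarrow> y \<in> V (Suc n) \<Longrightarrow> x + y \<in> V n"
    by blast+
  obtain f where f: "f 0 = 0" "\<And>x. 0 \<le> f x" "\<And>x. x \<notin> V 0 \<Longrightarrow> 1 \<le> f x"
    "\<And>n x v. v \<in> V n \<Longrightarrow> f (x + v) \<le> f x + (2::real) / 2 ^ n"
    using uniformly_continuous_separation[of V, OF V(4) nbhd_zero_0[OF V(1)]] by blast
  define g where "g x = max 0 (1 - f x)" for x
  show ?thesis
  proof (intro exI[of _ g] conjI allI impI)
    show "g 0 = 1" "0 \<le> g x" "g x \<le> 1" for x using f by (auto simp: g_def)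
    show "g x = 0" if "x \<notin> U" for x
    proof -
      have "1 \<le> f x" using that \<open>W\<^sub>0 \<subseteq> U\<close> V(3) by (intro f(3)) auto
      then show ?thesis by (simp add: g_def)
    qed
    show "nbhd_zero T {v. \<forall>x. \<bar>g (x + v) - g x\<bar> \<le> e}" if e: "0 < e" for e
    proof -
      obtain n where n: "(1/2) ^ n < e / 2" using real_arch_pow_inv[of "e/2" "1/2"] e by auto
      have "V n \<subseteq> {v. \<forall>x. \<bar>g (x + v) - g x\<bar> \<le> e}"
      proof clarify
        fix v x assume v: "v \<in> V n"
        have "f (x + v) \<le> f x + 2 / 2 ^ n" using f(4)[OF v] .
        moreover have "f x \<le> f (x + v) + 2 / 2 ^ n" using f(4)[OF V(2)[OF v], of "x + v"] by simp
        moreover have "2 / 2 ^ n < e" using n by (simp add: power_divide)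
        ultimately show "\<bar>g (x + v) - g x\<bar> \<le> e" unfolding g_def by linarith
      qed
      then show ?thesis using V(1) nbhd_zero_mono by blast
    qed
  qed
qed

text \<open>The kernel \<open>k (x, y)\<close> is a limit of averages of \<open>g (x + z) * g (y + z)\<close> over \<open>z\<close> in Folner
  families, hence positive definite as a kernel and translation invariant.\<close>

lemma pos_def_autocorrelation:
  fixes T :: "'a::ab_group_add topology" and g :: "'a \<Rightarrow> real"
  assumes T: "tb_group_topology T"
    and g: "g 0 = 1" "\<And>x. 0 \<le> g x" "\<And>x. g x \<le> 1"
    and cont: "\<And>e. 0 < e \<Longrightarrow> nbhd_zero T {v. \<forall>x. \<bar>g (x + v) - g x\<bar> \<le> e}"
  shows "\<exists>\<phi>. pos_def \<phi> \<and> 0 < Re (\<phi> 0) \<and> (\<forall>e>0. nbhd_zero T {x. Re (\<phi> 0) - Re (\<phi> x) \<le> e}) \<and>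
    (\<forall>x. (\<forall>z. g (x + z) * g z = 0) \<longrightarrow> \<phi> x = 0)"
proof -
  define B where "B = {x. 1 / 2 \<le> g x}"
  have "nbhd_zero T B"
  proof (rule nbhd_zero_mono[OF cont[of "1/2"]])
    show "{v. \<forall>x. \<bar>g (x + v) - g x\<bar> \<le> 1 / 2} \<subseteq> B"
    proof clarify
      fix v assume "\<forall>x. \<bar>g (x + v) - g x\<bar> \<le> 1 / 2"
      from spec[OF this, of 0] have "\<bar>g v - 1\<bar> \<le> 1 / 2" by (simp add: g(1))
      then have "1 / 2 \<le> g v" by arith
      then show "v \<in> B" by (simp add: B_def)
    qed
  qed simp
  then obtain F where F: "finite F" "UNIV \<subseteq> (\<Union>g\<in>F. (+) g ` B)"
    by (rule tb_group_topology_cover[OF T])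
  have "F \<noteq> {}" using F(2) by auto
  then have cF: "0 < real (card F)" using F(1) by (simp add: card_gt_0_iff)
  \<comment> \<open>A proportion \<open>1 / card F\<close> of the sample points will lie in
    \<open>B\<close>, where the square of \<open>g\<close> is at least 1/4.\<close>
  define c where "c = 1 / (4 * real (card F))"
  have c: "0 < c" using cF by (simp add: c_def)
  \<comment> \<open>Averages over a Folner family are only nearly translation invariant, hence a
    kernel of two variables. \<open>K\<close> contains what holds exactly for each average,
    \<open>Q\<close> the approximate invariance.\<close>
  define K where "K = {k :: 'a \<times> 'a \<Rightarrow> complex. \<forall>x. cmod (k x) \<le> 1} \<inter>
    {k. (\<forall>x y. k (y, x) = cnj (k (x, y))) \<and>
        (\<forall>n f (a :: nat \<Rightarrow> 'a). 0 \<le> Re (\<Sum>i<n. \<Sum>j<n. cnj (f i) * f j * k (a i, a j))) \<and>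
        c \<le> Re (k (0, 0)) \<and>
        (\<forall>x. (\<forall>z. g (x + z) * g z = 0) \<longrightarrow> k (x, 0) = 0) \<and>
        (\<forall>v e. (\<forall>x. \<bar>g (x + v) - g x\<bar> \<le> e) \<longrightarrow> cmod (k (v, 0) - k (0, 0)) \<le> e)}"
  define Q where "Q = (\<lambda>(x :: 'a, y :: 'a, a :: 'a, e :: real). {k :: 'a \<times> 'a \<Rightarrow> complex. cmod (k (x + a, y + a) - k (x, y)) \<le> e})"
  have K_compact: "compact K"
    unfolding K_def
    by (intro compact_Int_closed compact_bounded_functions closed_Collect_conj closed_Collect_imp open_Collect_const
        closed_Collect_all closed_Collect_eq closed_Collect_le continuous_intros)
  have Q_closed: "closed (Q z)" for z
    unfolding Q_def case_prod_unfold by (intro closed_Collect_le continuous_intros)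
  have fip: "K \<inter> (\<Inter>z\<in>Z. Q z) \<noteq> {}" if Z: "finite Z" "Z \<subseteq> UNIV \<times> UNIV \<times> UNIV \<times> {0<..}" for Z
  proof -
    define e where "e = Min (insert 1 ((\<lambda>(x, y, a, e). e) ` Z))"
    have e: "0 < e" using Z by (auto simp: e_def)
    have e_le: "e \<le> t" if "(x, y, a, t) \<in> Z" for x y a t
      unfolding e_def using Z that by (intro Min_le) (auto intro!: rev_image_eqI)
    define A where "A = (\<lambda>(x, y, a, e). a) ` Z"
    have "finite A" using Z by (simp add: A_def)
    then obtain n p where np: "folner_family A e n p" and dense: "real n \<le> real (card F) * real (card {i\<in>{..<n}. p i \<in> B})"
      using folner_family_dense[OF _ e F] by blast
    have n: "0 < n" using np by (simp add: folner_family_def)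
    define k :: "'a \<times> 'a \<Rightarrow> complex"
      where "k = (\<lambda>(x, y). (\<Sum>i<n. of_real (g (x + p i) * g (y + p i))) / of_nat n)"
    have gg: "\<bar>g x * g y\<bar> \<le> 1" for x y
      using mult_mono[of "g x" 1 "g y" 1] g by (simp add: abs_mult)
    have "cmod (k z) \<le> 1" for z
    proof -
      have "cmod (\<Sum>i<n. of_real (g (fst z + p i) * g (snd z + p i))) \<le> real (card {..<n}) * 1"
        using gg by (intro sum_norm_bound) (simp only: norm_of_real)
      then show ?thesis using n by (simp add: k_def case_prod_unfold norm_divide)
    qed
    moreover have "k (y, x) = cnj (k (x, y))" for x y
      by (simp add: k_def mult.commute)
    moreover have "0 \<le> Re (\<Sum>i<m. \<Sum>j<m. cnj (f i) * f j * k (a i, a j))" for m f and a :: "nat \<Rightarrow> 'a"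
    proof -
      \<comment> \<open>Interchanging the sums writes the form as the average of the squared moduli
        of the \<open>S l\<close>.\<close>
      define S where "S l = (\<Sum>i<m. f i * of_real (g (a i + p l)))" for l
      have "(\<Sum>i<m. \<Sum>j<m. cnj (f i) * f j * k (a i, a j))
        = (\<Sum>i<m. \<Sum>j<m. \<Sum>l<n. cnj (f i) * f j * of_real (g (a i + p l) * g (a j + p l))) / of_nat n"
        by (simp add: k_def sum_divide_distrib sum_distrib_left)
      also have "(\<Sum>i<m. \<Sum>j<m. \<Sum>l<n. cnj (f i) * f j * of_real (g (a i + p l) * g (a j + p l)))
        = (\<Sum>i<m. \<Sum>l<n. \<Sum>j<m. cnj (f i) * f j * of_real (g (a i + p l) * g (a j + p l)))"
        by (intro sum.cong refl sum.swap)
      also have "\<dots> = (\<Sum>l<n. \<Sum>i<m. \<Sum>j<m. cnj (f i) * f j * of_real (g (a i + p l) * g (a j + p l)))"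
        by (rule sum.swap)
      also have "\<dots> = (\<Sum>l<n. cnj (S l) * S l)"
        unfolding S_def cnj_sum sum_product complex_cnj_mult complex_cnj_complex_of_real of_real_mult
        by (intro sum.cong refl) (simp only: mult_ac)
      also have "\<dots> = of_real (\<Sum>l<n. (cmod (S l))\<^sup>2)"
        by (simp add: complex_norm_square mult.commute del: of_real_power)
      finally have "(\<Sum>i<m. \<Sum>j<m. cnj (f i) * f j * k (a i, a j)) = of_real ((\<Sum>l<n. (cmod (S l))\<^sup>2) / real n)"
        by simp
      moreover have "0 \<le> (\<Sum>l<n. (cmod (S l))\<^sup>2) / real n" by (intro divide_nonneg_nonneg sum_nonneg) auto
      ultimately show ?thesis by (simp only: Re_complex_of_real)
    qed
    moreover have "c \<le> Re (k (0, 0))"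
    proof -
      have "real (card {i\<in>{..<n}. p i \<in> B}) * (1/4) = (\<Sum>i\<in>{i\<in>{..<n}. p i \<in> B}. 1/2 * (1/2))" by simp
      also have "\<dots> \<le> (\<Sum>i\<in>{i\<in>{..<n}. p i \<in> B}. g (p i) * g (p i))"
        using g by (intro sum_mono mult_mono) (auto simp: B_def)
      also have "\<dots> \<le> (\<Sum>i<n. g (p i) * g (p i))" by (intro sum_mono2) auto
      finally have "real (card F) * (real (card {i\<in>{..<n}. p i \<in> B}) * (1/4)) \<le> real (card F) * (\<Sum>i<n. g (p i) * g (p i))"
        by (intro mult_left_mono) auto
      with dense have "real n / 4 \<le> real (card F) * (\<Sum>i<n. g (p i) * g (p i))" by simp
      then have "c \<le> (\<Sum>i<n. g (p i) * g (p i)) / real n"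
        using n cF by (simp add: c_def field_simps)
      moreover have "k (0, 0) = of_real ((\<Sum>i<n. g (p i) * g (p i)) / real n)" by (simp add: k_def)
      ultimately show ?thesis by (simp only: Re_complex_of_real)
    qed
    moreover have "k (x, 0) = 0" if "\<forall>z. g (x + z) * g z = 0" for x
      using that by (auto simp: k_def intro!: sum.neutral)
    moreover have "cmod (k (v, 0) - k (0, 0)) \<le> t" if v: "\<forall>x. \<bar>g (x + v) - g x\<bar> \<le> t" for v t
    proof -
      have "k (v, 0) - k (0, 0) = (\<Sum>i<n. of_real ((g (v + p i) - g (p i)) * g (p i))) / of_nat n"
        by (simp add: k_def algebra_simps sum_subtractf diff_divide_distrib)
      also have "cmod \<dots> \<le> (real (card {..<n}) * t) / real n"
        unfolding norm_divide norm_of_nat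
      proof (intro divide_right_mono sum_norm_bound)
        fix i
        have "\<bar>g (v + p i) - g (p i)\<bar> * \<bar>g (p i)\<bar> \<le> t * 1"
          using v[rule_format, of "p i"] g(2,3)[of "p i"] by (intro mult_mono) (auto simp: add.commute)
        then show "cmod (of_real ((g (v + p i) - g (p i)) * g (p i))) \<le> t"
          by (simp only: norm_of_real abs_mult)
      qed auto
      finally show ?thesis using n by simp
    qed
    ultimately have "k \<in> K" unfolding K_def by blast
    moreover have "k \<in> Q z" if "z \<in> Z" for z
    proof -
      obtain x y a t where z: "z = (x, y, a, t)" by (metis prod_cases4)
      have a: "a \<in> A" unfolding A_def using that z by force
      define h :: "'a \<Rightarrow> complex" where "h u = of_real (g (x + u) * g (y + u))" for u
      have "cmod (h u) \<le> 1" for u using gg by (simp only: h_def norm_of_real)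
      then have "cmod ((\<Sum>i<n. h (p i + a)) - (\<Sum>i<n. h (p i))) \<le> e * 1 * real n"
        by (rule folner_familyD[OF np a])
      then have "cmod ((\<Sum>i<n. h (p i + a)) - (\<Sum>i<n. h (p i))) / real n \<le> e" using n by (simp add: field_simps)
      moreover have "k (x + a, y + a) - k (x, y) = ((\<Sum>i<n. h (p i + a)) - (\<Sum>i<n. h (p i))) / of_nat n"
        by (simp add: k_def h_def diff_divide_distrib ac_simps)
      ultimately have "cmod (k (x + a, y + a) - k (x, y)) \<le> t"
        using e_le[of x y a t] that z by (simp add: norm_divide)
      then show ?thesis by (simp add: Q_def z)
    qed
    ultimately show ?thesis by blast
  qed
  have "K \<inter> (\<Inter>z\<in>UNIV \<times> UNIV \<times> UNIV \<times> {0<..}. Q z) \<noteq> {}"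
    by (rule compact_imp_fip_image[OF K_compact Q_closed fip])
  then obtain k where K: "k \<in> K" and Q: "\<And>x y a e. 0 < e \<Longrightarrow> k \<in> Q (x, y, a, e)" by fastforce
  have inv: "k (x + a, y + a) = k (x, y)" for x y a
  proof -
    have "cmod (k (x + a, y + a) - k (x, y)) \<le> 0 + e" if "0 < e" for e
      using Q[OF that, of x y a] by (simp add: Q_def)
    then have "cmod (k (x + a, y + a) - k (x, y)) \<le> 0" by (rule field_le_epsilon)
    then show ?thesis by simp
  qed
  define \<phi> where "\<phi> x = k (x, 0)" for x
  have K_zero: "\<forall>x. (\<forall>z. g (x + z) * g z = 0) \<longrightarrow> \<phi> x = 0"
    using K unfolding K_def \<phi>_def Int_iff mem_Collect_eq by (elim conjE)
  have K_pos: "c \<le> Re (\<phi> 0)"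
    using K unfolding K_def \<phi>_def Int_iff mem_Collect_eq by (elim conjE)
  have K_herm: "\<forall>x y. k (y, x) = cnj (k (x, y))"
    using K unfolding K_def Int_iff mem_Collect_eq by (elim conjE)
  have K_pd: "\<forall>n f (a :: nat \<Rightarrow> 'a). 0 \<le> Re (\<Sum>i<n. \<Sum>j<n. cnj (f i) * f j * k (a i, a j))"
    using K unfolding K_def Int_iff mem_Collect_eq by (elim conjE)
  have K_cont: "\<forall>v e. (\<forall>x. \<bar>g (x + v) - g x\<bar> \<le> e) \<longrightarrow> cmod (\<phi> v - \<phi> 0) \<le> e"
    using K unfolding K_def \<phi>_def Int_iff mem_Collect_eq by (elim conjE)
  have k_eq: "k (x, y) = \<phi> (x - y)" for x y
    using inv[of "x - y" y 0] by (simp add: \<phi>_def)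
  have "pos_def \<phi>"
    unfolding pos_def_def
  proof (intro conjI allI)
    show "\<phi> (- x) = cnj (\<phi> x)" for x
      using K_herm[rule_format, of 0 x] k_eq[of 0 x] by (simp add: \<phi>_def)
    show "0 \<le> Re (pd_form \<phi> {..<n} f a {..<n} f a)" for n :: nat and f a
      using K_pd[unfolded k_eq] unfolding pd_form_def by blast
  qed
  moreover have "0 < Re (\<phi> 0)" using K_pos c by linarith
  moreover have "nbhd_zero T {x. Re (\<phi> 0) - Re (\<phi> x) \<le> e}" if e: "0 < e" for e
  proof (rule nbhd_zero_mono[OF cont[OF e]], clarify)
    fix v assume "\<forall>x. \<bar>g (x + v) - g x\<bar> \<le> e"
    then have "cmod (\<phi> v - \<phi> 0) \<le> e" using K_cont by blast
    then show "Re (\<phi> 0) - Re (\<phi> v) \<le> e" using abs_Re_le_cmod[of "\<phi> v - \<phi> 0"] by simp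
  qed
  moreover have "\<phi> x = 0" if "\<forall>z. g (x + z) * g z = 0" for x
    using K_zero that by blast
  ultimately show ?thesis by blast
qed

text \<open>Here \<open>\<phi>\<close> comes from the autocorrelation of a bump vanishing off a
  symmetric \<open>W\<close> with \<open>W + W\<close> inside \<open>U\<close>. If
  \<open>\<phi> x\<close> is nonzero, then \<open>x + z\<close> and \<open>z\<close> lie in
  \<open>W\<close> for some \<open>z\<close>, so \<open>x\<close> lies in \<open>U\<close>.\<close>

theorem tb_group_topology_circle_chars:
  fixes T :: "'a::ab_group_add topology"
  assumes T: "tb_group_topology T" and U: "nbhd_zero T U"
  shows "\<exists>X e. finite X \<and> 0 < e \<and>
    (\<forall>\<xi>\<in>X. circle_char \<xi> \<and> (\<forall>r>0. nbhd_zero T {x. 1 - Re (\<xi> x) < r})) \<and>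
    {x. \<forall>\<xi>\<in>X. 1 - Re (\<xi> x) < e} \<subseteq> U"
proof -
  have gT: "group_topology T" using T by (simp add: tb_group_topology_def)
  obtain W where W: "nbhd_zero T W" "\<And>x y. x \<in> W \<Longrightarrow> y \<in> W \<Longrightarrow> x + y \<in> U" "\<And>x. x \<in> W \<Longrightarrow> - x \<in> W"
    using group_topology_add[OF gT U] by metis
  obtain g :: "'a \<Rightarrow> real" where g: "g 0 = 1" "\<And>x. 0 \<le> g x" "\<And>x. g x \<le> 1" "\<And>x. x \<notin> W \<Longrightarrow> g x = 0"
    "\<And>e. 0 < e \<Longrightarrow> nbhd_zero T {v. \<forall>x. \<bar>g (x + v) - g x\<bar> \<le> e}"
    using group_topology_bump[OF gT W(1)] by blast
  obtain \<phi> where \<phi>: "pos_def \<phi>" "0 < Re (\<phi> 0)" "\<And>e. 0 < e \<Longrightarrow> nbhd_zero T {x. Re (\<phi> 0) - Re (\<phi> x) \<le> e}"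
    and zero: "\<And>x. \<forall>z. g (x + z) * g z = 0 \<Longrightarrow> \<phi> x = 0"
    using pos_def_autocorrelation[OF T g(1-3,5)] by metis
  have U_\<phi>: "x \<in> U" if nz: "\<phi> x \<noteq> 0" for x
  proof -
    obtain z where "g (x + z) \<noteq> 0" "g z \<noteq> 0" using nz zero[of x] by auto
    then have "x + z \<in> W" "- z \<in> W" using g(4) W(3) by blast+
    then show ?thesis using W(2)[of "x + z" "- z"] by simp
  qed
  show ?thesis by (rule pos_def_controls_circle_chars[OF T \<phi>(1,3,2) U_\<phi>])
qed

subsection \<open>Polars of neighbourhoods of zero\<close>

lemma nbhd_zero_Int: "nbhd_zero T U \<Longrightarrow> nbhd_zero T W \<Longrightarrow> nbhd_zero T (U \<inter> W)"
  unfolding nbhd_zero_def by (metis Int_iff Int_mono openin_Int)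

lemma nbhd_zero_INT:
  assumes "group_topology T" "finite X" "\<And>i. i \<in> X \<Longrightarrow> nbhd_zero T (U i)"
  shows "nbhd_zero T (\<Inter>i\<in>X. U i)"
  using assms(2,3)
proof induction
  case empty
  have "openin T UNIV" using assms(1) openin_topspace[of T] by (simp add: group_topology_def)
  then show ?case by (auto simp: nbhd_zero_def)
next
  case (insert i X)
  then show ?case by (simp add: nbhd_zero_Int)
qed

text \<open>Translations are continuous, so a group topology is determined by its neighbourhoods of
  zero.\<close>

lemma coarser_topology_nbhd_zero:
  assumes T: "group_topology T" and T': "group_topology T'"
    and le: "\<And>U. nbhd_zero T' U \<Longrightarrow> nbhd_zero T U"
  shows "coarser_topology T' T"
proof -
  have shift: "openin S {x. x + a \<in> U}" if S: "group_topology S" and U: "openin S U" for S a and U :: "'a set"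
  proof -
    have top: "topspace S = UNIV" and add: "continuous_map (prod_topology S S) S (\<lambda>(x, y). x + y)"
      using S by (auto simp: group_topology_def)
    have "continuous_map S (prod_topology S S) (\<lambda>x. (x, a))"
      using top by (simp add: continuous_map_pairwise o_def)
    from continuous_map_compose[OF this add] have "continuous_map S S (\<lambda>x. x + a)"
      by (simp add: o_def)
    from openin_continuous_map_preimage[OF this U] show ?thesis using top by simp
  qed
  have "openin T U" if U: "openin T' U" for U
  proof (subst openin_subopen, intro ballI)
    fix x assume "x \<in> U"
    then have "nbhd_zero T' {y. y + x \<in> U}"
      unfolding nbhd_zero_def using shift[OF T' U, of x] by (intro exI[of _ "{y. y + x \<in> U}"]) auto
    then have "nbhd_zero T {y. y + x \<in> U}" by (rule le)
    then obtain V where V: "openin T V" "0 \<in> V" "V \<subseteq> {y. y + x \<in> U}" by (auto simp: nbhd_zero_def)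
    have "openin T {z. z + (- x) \<in> V}" by (rule shift[OF T V(1)])
    moreover have "x \<in> {z. z + (- x) \<in> V}" using V(2) by simp
    moreover have "{z. z + (- x) \<in> V} \<subseteq> U"
    proof clarify
      fix z assume "z + (- x) \<in> V"
      then have "(z + (- x)) + x \<in> U" using V(3) by blast
      then show "z \<in> U" by simp
    qed
    ultimately show "\<exists>W. openin T W \<and> x \<in> W \<and> W \<subseteq> U" by blast
  qed
  then show ?thesis by (auto simp: coarser_topology_def)
qed

text \<open>Metrizability enters through first countability; finite intersections make the countable
  base at zero decreasing.\<close>

lemma metrizable_nbhd_zero_base:
  assumes T: "group_topology T" and m: "metrizable_space T"
  obtains A :: "nat \<Rightarrow> 'a::ab_group_add set" where "\<And>n. nbhd_zero T (A n)" "\<And>m n. m \<le> n \<Longrightarrow> A n \<subseteq> A m"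
    "\<And>U. nbhd_zero T U \<Longrightarrow> \<exists>n. A n \<subseteq> U"
proof -
  have top: "topspace T = UNIV" using T by (simp add: group_topology_def)
  obtain B where B: "countable B" "\<And>V. V \<in> B \<Longrightarrow> openin T V"
    "\<And>U. openin T U \<Longrightarrow> 0 \<in> U \<Longrightarrow> \<exists>V\<in>B. 0 \<in> V \<and> V \<subseteq> U"
    using metrizable_imp_first_countable[OF m] top unfolding first_countable_def by (metis UNIV_I)
  define C where "C = {V \<in> B. 0 \<in> V}"
  have C: "countable C" "C \<noteq> {}"
    using B(1) B(3)[of "topspace T"] openin_topspace[of T] top by (auto simp: C_def)
  define A where "A n = (\<Inter>i\<in>{..n}. from_nat_into C i)" for n
  have mem: "from_nat_into C i \<in> C" for i using C(2) by (rule from_nat_into)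
  show ?thesis
  proof
    show "nbhd_zero T (A n)" for n
      unfolding A_def using mem B(2) by (intro nbhd_zero_INT[OF T]) (auto simp: C_def nbhd_zero_def)
    show "A n \<subseteq> A m" if "m \<le> n" for m n using that by (auto simp: A_def)
    show "\<exists>n. A n \<subseteq> U" if U: "nbhd_zero T U" for U
    proof -
      obtain V where "V \<in> C" "V \<subseteq> U"
        using U B(3) unfolding nbhd_zero_def C_def by (metis (no_types, lifting) mem_Collect_eq order_trans)
      moreover then obtain n where "from_nat_into C n = V" using C(1) from_nat_into_surj by metis
      ultimately show ?thesis by (auto simp: A_def)
    qed
  qed
qed

section \<open>Characters close to 1\<close>

lemma circle_doubling:
  fixes z :: complex
  assumes "cmod (z - 1) \<le> 3 / 4"
  shows "5 / 4 * cmod (z - 1) \<le> cmod (z * z - 1)"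
proof -
  \<comment> \<open>\<open>z * z - 1\<close> factors, and \<open>cmod (z + 1)\<close> is at least
    \<open>2 - 3/4\<close>.\<close>
  have "2 - cmod (z - 1) \<le> cmod (z + 1)"
    using norm_triangle_ineq4[of "z + 1" "z - 1"] by simp
  then have "5 / 4 * cmod (z - 1) \<le> cmod (z + 1) * cmod (z - 1)"
    using assms by (intro mult_right_mono) auto
  also have "\<dots> = cmod (z * z - 1)" by (simp add: algebra_simps flip: norm_mult)
  finally show ?thesis .
qed

text \<open>The circle has no small subgroups: doubling the argument expands the distance from 1 by
  5/4, so a distance bounded by 3/4 everywhere must vanish.\<close>

lemma circle_char_trivial:
  assumes \<xi>: "circle_char \<xi>" and small: "\<And>x. cmod (\<xi> x - 1) \<le> 3 / 4"
  shows "\<xi> x = 1"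
proof -
  have bound: "cmod (\<xi> x - 1) \<le> 3 / 4 * (4 / 5) ^ n" for n x
  proof (induction n arbitrary: x)
    case (Suc n)
    have "5 / 4 * cmod (\<xi> x - 1) \<le> cmod (\<xi> (x + x) - 1)"
      using circle_doubling[OF small] by (simp add: circle_char_add[OF \<xi>])
    then show ?case using Suc[of "x + x"] by simp
  qed (use small in auto)
  have "(\<lambda>n. 3 / 4 * (4 / 5 :: real) ^ n) \<longlonglongrightarrow> 3 / 4 * 0"
    by (intro tendsto_intros) auto
  then have "cmod (\<xi> x - 1) \<le> 3 / 4 * 0"
    by (rule LIMSEQ_le_const) (use bound in blast)
  then show ?thesis by simp
qed

text \<open>The same expansion read backwards: if \<open>x\<close> is within 3/4 and
  \<open>x + x\<close> within \<open>(4 / 5) ^ n\<close>, then \<open>x\<close> is within the next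
  power. So one fixed radius already gives continuity.\<close>

lemma circle_char_continuous:
  assumes T: "group_topology T" and \<xi>: "circle_char \<xi>" and small: "nbhd_zero T {x. cmod (\<xi> x - 1) \<le> 1 / 4}"
    and r: "0 < r"
  shows "nbhd_zero T {x. cmod (\<xi> x - 1) < r}"
proof -
  have small': "nbhd_zero T {x. cmod (\<xi> x - 1) \<le> 3 / 4}"
    by (rule nbhd_zero_mono[OF small]) auto
  have pow: "nbhd_zero T {x. cmod (\<xi> x - 1) \<le> (4 / 5) ^ n}" for n
  proof (induction n)
    case 0
    then show ?case by (rule nbhd_zero_mono[OF small']) auto
  next
    case (Suc n)
    obtain W where W: "nbhd_zero T W" "\<And>x y. x \<in> W \<Longrightarrow> y \<in> W \<Longrightarrow> x + y \<in> {x. cmod (\<xi> x - 1) \<le> (4 / 5) ^ n}"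
      using group_topology_add[OF T Suc] by metis
    have "W \<inter> {x. cmod (\<xi> x - 1) \<le> 3 / 4} \<subseteq> {x. cmod (\<xi> x - 1) \<le> (4 / 5) ^ Suc n}"
    proof clarify
      fix x assume x: "x \<in> W" "cmod (\<xi> x - 1) \<le> 3 / 4"
      have "5 / 4 * cmod (\<xi> x - 1) \<le> cmod (\<xi> (x + x) - 1)"
        using circle_doubling[OF x(2)] by (simp add: circle_char_add[OF \<xi>])
      then show "cmod (\<xi> x - 1) \<le> (4 / 5) ^ Suc n" using W(2)[OF x(1) x(1)] by simp
    qed
    then show ?case using nbhd_zero_mono nbhd_zero_Int[OF W(1) small'] by blast
  qed
  obtain n where "(4 / 5) ^ n < r" using real_arch_pow_inv[OF r, of "4/5"] by auto
  then show ?thesis by (intro nbhd_zero_mono[OF pow[of n]]) auto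
qed

text \<open>On \<open>A\<close> two members differ by at most 1/2. This leaves room for a further
  error of 1/4 before the threshold 3/4 of \<open>circle_char_trivial\<close> is passed.\<close>

definition char_polar :: "'a::ab_group_add set \<Rightarrow> ('a \<Rightarrow> complex) set" where
  "char_polar A = {\<xi>. circle_char \<xi> \<and> (\<forall>x\<in>A. cmod (\<xi> x - 1) \<le> 1 / 4)}"

lemma char_polar_closed: "closed (char_polar A)"
  unfolding char_polar_def circle_char_def Ball_def
  by (intro closed_Collect_conj closed_Collect_all closed_Collect_imp open_Collect_const
      closed_Collect_eq closed_Collect_le continuous_intros)

text \<open>For \<open>A = {}\<close> this is the compactness of the set of all characters.\<close>

lemma char_polar_compact: "compact (char_polar A)"
proof -
  have "char_polar A \<subseteq> {\<xi>. \<forall>x. cmod (\<xi> x) \<le> 1}"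
    by (auto simp: char_polar_def circle_char_norm)
  then show ?thesis
    using compact_Int_closed[OF compact_bounded_functions[of 1] char_polar_closed, of A]
    by (simp only: Int_absorb1)
qed

text \<open>Two characters in the polar of \<open>A\<close> which are close on \<open>F\<close> are uniformly close, hence equal.\<close>

lemma finite_char_polar:
  assumes F: "finite F" "UNIV \<subseteq> (\<Union>g\<in>F. (+) g ` A)"
  shows "finite (char_polar A)"
proof -
  \<comment> \<open>Cells have side 1/8, so real and imaginary parts together vary by at most
    1/4.\<close>
  define cell where "cell z = (\<lfloor>8 * Re z\<rfloor>, \<lfloor>8 * Im z\<rfloor>)" for z
  define J where "J = {-8..8::int} \<times> {-8..8::int}"
  have cell_close: "cmod (z - w) \<le> 1 / 4" if "cell z = cell w" for z w
  proof -
    have "\<lfloor>8 * Re z\<rfloor> = \<lfloor>8 * Re w\<rfloor>" "\<lfloor>8 * Im z\<rfloor> = \<lfloor>8 * Im w\<rfloor>" using that by (auto simp: cell_def)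
    then have "\<bar>8 * Re z - 8 * Re w\<bar> \<le> 1" "\<bar>8 * Im z - 8 * Im w\<bar> \<le> 1" by linarith+
    then have "\<bar>Re (z - w)\<bar> + \<bar>Im (z - w)\<bar> \<le> 1 / 4" unfolding minus_complex.sel by linarith
    then show ?thesis using cmod_le[of "z - w"] by linarith
  qed
  have "inj_on (\<lambda>\<xi>. \<lambda>g\<in>F. cell (\<xi> g)) (char_polar A)"
  proof (rule inj_onI)
    fix \<xi> \<eta> assume \<xi>: "\<xi> \<in> char_polar A" and \<eta>: "\<eta> \<in> char_polar A"
      and eq: "(\<lambda>g\<in>F. cell (\<xi> g)) = (\<lambda>g\<in>F. cell (\<eta> g))"
    have ch: "circle_char \<xi>" "circle_char \<eta>" using \<xi> \<eta> by (auto simp: char_polar_def)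
    \<comment> \<open>The quotient of the two characters. At \<open>x = g + a\<close> its distance
      from 1 is at most 1/4, from the cell at \<open>g\<close>, plus 1/2, from the polar at
      \<open>a\<close>.\<close>
    define \<zeta> where "\<zeta> x = \<xi> x * cnj (\<eta> x)" for x
    have "circle_char \<zeta>"
      using ch by (simp add: circle_char_def \<zeta>_def norm_mult)
    moreover have "cmod (\<zeta> x - 1) \<le> 3 / 4" for x
    proof -
      obtain g a where x: "x = g + a" "g \<in> F" "a \<in> A" using F(2) by blast
      have "cmod (\<xi> g - \<eta> g) \<le> 1 / 4"
        using fun_cong[OF eq, of g] x(2) by (intro cell_close) simp
      moreover have "cmod (\<xi> a - \<eta> a) \<le> 1 / 2"
      proof -
        have "cmod (\<xi> a - 1) \<le> 1 / 4" "cmod (\<eta> a - 1) \<le> 1 / 4" using \<xi> \<eta> x(3) by (auto simp: char_polar_def)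
        then show ?thesis using norm_triangle_ineq4[of "\<xi> a - 1" "\<eta> a - 1"] by simp
      qed
      moreover have "\<xi> x - \<eta> x = (\<xi> g - \<eta> g) * \<xi> a + \<eta> g * (\<xi> a - \<eta> a)"
        by (simp add: x circle_char_add[OF ch(1)] circle_char_add[OF ch(2)] algebra_simps)
      then have "cmod (\<xi> x - \<eta> x) \<le> cmod (\<xi> g - \<eta> g) + cmod (\<xi> a - \<eta> a)"
        using norm_triangle_ineq[of "(\<xi> g - \<eta> g) * \<xi> a" "\<eta> g * (\<xi> a - \<eta> a)"]
        by (simp add: norm_mult circle_char_norm[OF ch(1)] circle_char_norm[OF ch(2)])
      moreover have "\<zeta> x - 1 = (\<xi> x - \<eta> x) * cnj (\<eta> x)"
        using circle_char_norm[OF ch(2), of x] by (simp add: \<zeta>_def algebra_simps complex_norm_square[symmetric])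
      then have "cmod (\<zeta> x - 1) = cmod (\<xi> x - \<eta> x)"
        by (simp add: norm_mult circle_char_norm[OF ch(2)])
      ultimately show ?thesis by linarith
    qed
    ultimately have \<zeta>: "\<zeta> x = 1" for x by (rule circle_char_trivial)
    show "\<xi> = \<eta>"
    proof
      fix x
      have "\<eta> x * cnj (\<eta> x) = 1"
        using circle_char_norm[OF ch(2), of x] by (simp add: complex_norm_square[symmetric])
      then show "\<xi> x = \<eta> x" using \<zeta>[of x] unfolding \<zeta>_def by (metis mult.commute mult.left_commute mult.right_neutral)
    qed
  qed
  moreover have "(\<lambda>\<xi>. \<lambda>g\<in>F. cell (\<xi> g)) ` char_polar A \<subseteq> PiE F (\<lambda>_. J)"
  proof (rule image_subsetI)
    fix \<xi> assume "\<xi> \<in> char_polar A"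
    then have "cmod (\<xi> g) = 1" for g by (simp add: char_polar_def circle_char_norm)
    then have "\<bar>Re (\<xi> g)\<bar> \<le> 1" "\<bar>Im (\<xi> g)\<bar> \<le> 1" for g
      using abs_Re_le_cmod[of "\<xi> g"] abs_Im_le_cmod[of "\<xi> g"] by auto
    moreover have "-8 \<le> \<lfloor>8 * t\<rfloor>" "\<lfloor>8 * t\<rfloor> \<le> 8" if "\<bar>t\<bar> \<le> 1" for t :: real
      using that by linarith+
    ultimately have "cell (\<xi> g) \<in> J" for g
      unfolding cell_def J_def by simp
    then show "(\<lambda>g\<in>F. cell (\<xi> g)) \<in> PiE F (\<lambda>_. J)" by auto
  qed
  moreover have "finite (PiE F (\<lambda>_. J))" using F(1) by (intro finite_PiE) (auto simp: J_def)
  ultimately show ?thesis by (metis finite_imageD finite_subset)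
qed

section \<open>Finite blocks of group elements\<close>

lemma enumerate_finite_blocks:
  assumes "\<And>n. finite (F n)" "\<And>n. F n \<noteq> {}"
  obtains u :: "nat \<Rightarrow> 'a" where
    "\<And>P. (\<forall>\<^sub>F k in sequentially. P (u k)) \<longleftrightarrow> (\<forall>\<^sub>F n in sequentially. \<forall>x\<in>F n. P x)"
proof -
  \<comment> \<open>Tagging makes the blocks disjoint, and nonempty blocks make \<open>S\<close>
    infinite. Any bijection of the indices with \<open>S\<close> will do, because each block
    occupies only finitely many of them.\<close>
  define S where "S = (SIGMA n:UNIV :: nat set. F n)"
  have "fst ` S = UNIV" using assms(2) by (force simp: S_def)
  then have "infinite S" by (metis finite_imageI infinite_UNIV_nat)
  moreover have "countable S"
    unfolding S_def using assms(1) by (intro countable_SIGMA) (auto intro: countable_finite)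
  ultimately have e: "bij_betw (from_nat_into S) UNIV S" by (intro bij_betw_from_nat_into)
  define e where "e = from_nat_into S"
  have inj: "inj e" and ran: "range e = S" using e by (auto simp: e_def bij_betw_def)
  have "(\<forall>\<^sub>F k in sequentially. P (snd (e k))) \<longleftrightarrow> (\<forall>\<^sub>F n in sequentially. \<forall>x\<in>F n. P x)" for P
  proof
    assume "\<forall>\<^sub>F k in sequentially. P (snd (e k))"
    then obtain N where N: "\<And>k. N \<le> k \<Longrightarrow> P (snd (e k))" by (auto simp: eventually_sequentially)
    \<comment> \<open>Larger than the block number of each of the first \<open>N\<close>
      terms.\<close>
    define m where "m = Suc (\<Sum>k<N. fst (e k))"
    have "P x" if "m \<le> n" "x \<in> F n" for n x
    proof -
      have "(n, x) \<in> range e" using that(2) by (simp add: ran S_def)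
      then obtain k where k: "e k = (n, x)" by (metis rangeE)
      have "N \<le> k"
      proof (rule ccontr)
        assume "\<not> N \<le> k"
        then have "fst (e k) \<le> (\<Sum>k<N. fst (e k))" by (intro member_le_sum) auto
        then show False using k that(1) by (simp add: m_def)
      qed
      then show ?thesis using N[of k] k by simp
    qed
    then show "\<forall>\<^sub>F n in sequentially. \<forall>x\<in>F n. P x" by (auto simp: eventually_sequentially)
  next
    assume "\<forall>\<^sub>F n in sequentially. \<forall>x\<in>F n. P x"
    then obtain N where N: "\<And>n x. N \<le> n \<Longrightarrow> x \<in> F n \<Longrightarrow> P x" by (auto simp: eventually_sequentially)
    have "finite (SIGMA n:{..<N}. F n)" using assms(1) by auto
    then have "finite (e -` (SIGMA n:{..<N}. F n))" using inj by (rule finite_vimageI)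
    moreover have "P (snd (e k))" if "k \<notin> e -` (SIGMA n:{..<N}. F n)" for k
    proof -
      obtain n x where nx: "e k = (n, x)" by fastforce
      then have "x \<in> F n" using ran by (metis S_def SigmaE2 rangeI)
      then show ?thesis using that N[of n x] nx by force
    qed
    then have "{k. \<not> P (snd (e k))} \<subseteq> e -` (SIGMA n:{..<N}. F n)" by blast
    ultimately have "finite {k. \<not> P (snd (e k))}" by (rule rev_finite_subset)
    then show "\<forall>\<^sub>F k in sequentially. P (snd (e k))"
      unfolding cofinite_eq_sequentially[symmetric] eventually_cofinite .
  qed
  then show ?thesis by (rule that)
qed

lemma char_polar_antimono: "A \<subseteq> B \<Longrightarrow> char_polar B \<subseteq> char_polar A"
  by (auto simp: char_polar_def)

text \<open>\<open>char_polar A\<close> is the intersection of the polars of the points of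
  \<open>A\<close>. Were no finite subset enough, compactness would give a member of
  \<open>char_polar A \<inter> C\<close> outside \<open>N\<close>.\<close>

lemma char_polar_finite_subset:
  assumes C: "compact C" and N: "open N" and sub: "char_polar A \<inter> C \<subseteq> N"
  obtains Z where "finite Z" "Z \<subseteq> A" "char_polar Z \<inter> C \<subseteq> N"
proof -
  have "\<exists>Z. finite Z \<and> Z \<subseteq> A \<and> char_polar Z \<inter> C \<subseteq> N"
  proof (rule ccontr)
    assume no: "\<not> ?thesis"
    have "compact (C \<inter> (char_polar {} \<inter> - N))"
      using C char_polar_closed N by (intro compact_Int_closed closed_Int closed_Compl)
    then have "(C \<inter> (char_polar {} \<inter> - N)) \<inter> (\<Inter>x\<in>A. char_polar {x}) \<noteq> {}"
    proof (rule compact_imp_fip_image)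
      fix Z assume Z: "finite Z" "Z \<subseteq> A"
      then obtain \<xi> where "\<xi> \<in> char_polar Z" "\<xi> \<in> C" "\<xi> \<notin> N" using no by blast
      then show "(C \<inter> (char_polar {} \<inter> - N)) \<inter> (\<Inter>x\<in>Z. char_polar {x}) \<noteq> {}"
        by (auto simp: char_polar_def)
    qed (rule char_polar_closed)
    moreover have "char_polar {} \<inter> (\<Inter>x\<in>A. char_polar {x}) \<subseteq> char_polar A"
      by (auto simp: char_polar_def)
    ultimately show False using sub by blast
  qed
  then show ?thesis using that by blast
qed

text \<open>Every block \<open>F n\<close> consists of two parts: \<open>X n\<close> excludes the characters of
  \<open>char_polar (A (Suc n))\<close> outside \<open>char_polar (A n)\<close>, and \<open>Z m n\<close> confines a character in the
  polars of \<open>X m, \<dots>, X (n - 1)\<close> to the \<open>n\<close>-th neighbourhood of \<open>char_polar (A m)\<close>.\<close>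

lemma finite_blocks_determine_polars:
  fixes A :: "nat \<Rightarrow> 'a::ab_group_add set"
  assumes count: "countable (UNIV :: 'a set)"
    and fin: "\<And>n. finite (char_polar (A n))"
  shows "\<exists>F. (\<forall>n. finite (F n)) \<and> (\<forall>n. F n \<subseteq> A n) \<and>
    (\<forall>\<xi> m. (\<forall>j\<ge>m. \<xi> \<in> char_polar (F j)) \<longrightarrow> \<xi> \<in> char_polar (A m))"
proof -
  define g where "g = from_nat_into (UNIV :: 'a set)"
  have surj: "\<exists>i. g i = x" for x
    using from_nat_into_surj[OF count, of x] by (simp add: g_def)
  \<comment> \<open>Shrinking basic neighbourhoods for pointwise convergence, controlling the first
    \<open>n\<close> elements of the enumerated group.\<close>
  define near where "near n \<kappa> = {\<xi> :: 'a \<Rightarrow> complex. \<forall>i\<in>{..<n}. cmod (\<xi> (g i) - \<kappa> (g i)) < 1 / real (Suc n)}" for n \<kappa>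
  define N where "N m n = (\<Union>\<kappa>\<in>char_polar (A m). near n \<kappa>)" for m n
  have near_open: "open (near n \<kappa>)" for n \<kappa>
  proof -
    have "near n \<kappa> = (\<Inter>i\<in>{..<n}. {\<xi>. cmod (\<xi> (g i) - \<kappa> (g i)) < 1 / real (Suc n)})"
      by (auto simp: near_def)
    also have "open \<dots>"
      by (intro open_INT ballI open_Collect_less continuous_intros) auto
    finally show ?thesis .
  qed
  have N_open: "open (N m n)" for m n
    unfolding N_def by (intro open_UN ballI near_open)
  have near_self: "\<kappa> \<in> near n \<kappa>" for n \<kappa> by (simp add: near_def)
  \<comment> \<open>One point of \<open>A n\<close> is taken for each of the finitely many
    characters to be excluded.\<close>
  have "\<exists>X. finite X \<and> X \<subseteq> A n \<and> char_polar X \<inter> char_polar (A (Suc n)) \<subseteq> char_polar (A n)" for n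
  proof -
    have "\<forall>\<kappa>\<in>char_polar (A (Suc n)) - char_polar (A n). \<exists>x\<in>A n. \<not> cmod (\<kappa> x - 1) \<le> 1 / 4"
      by (auto simp: char_polar_def)
    then obtain w where w: "\<And>\<kappa>. \<kappa> \<in> char_polar (A (Suc n)) - char_polar (A n) \<Longrightarrow>
        w \<kappa> \<in> A n \<and> \<not> cmod (\<kappa> (w \<kappa>) - 1) \<le> 1 / 4"
      by metis
    have "char_polar (w ` (char_polar (A (Suc n)) - char_polar (A n))) \<inter> char_polar (A (Suc n)) \<subseteq> char_polar (A n)"
    proof clarify
      fix \<kappa> assume \<kappa>: "\<kappa> \<in> char_polar (w ` (char_polar (A (Suc n)) - char_polar (A n)))" "\<kappa> \<in> char_polar (A (Suc n))"
      show "\<kappa> \<in> char_polar (A n)"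
      proof (rule ccontr)
        assume "\<kappa> \<notin> char_polar (A n)"
        then have "\<kappa> \<in> char_polar (A (Suc n)) - char_polar (A n)" using \<kappa>(2) by simp
        moreover from this have "cmod (\<kappa> (w \<kappa>) - 1) \<le> 1 / 4" using \<kappa>(1) unfolding char_polar_def by blast
        ultimately show False using w by blast
      qed
    qed
    then show ?thesis using w fin[of "Suc n"]
      by (intro exI[of _ "w ` (char_polar (A (Suc n)) - char_polar (A n))"]) auto
  qed
  then obtain X where X: "\<And>n. finite (X n)" "\<And>n. X n \<subseteq> A n"
    "\<And>n. char_polar (X n) \<inter> char_polar (A (Suc n)) \<subseteq> char_polar (A n)"
    by metis
  \<comment> \<open>The factor \<open>char_polar {}\<close> keeps \<open>C m n\<close> inside the
    compact set of all characters, also for the empty range \<open>m = n\<close>.\<close>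
  define C where "C m n = (\<Inter>j\<in>{m..<n}. char_polar (X j)) \<inter> char_polar {}" for m n
  have C_compact: "compact (C m n)" for m n
  proof -
    have "closed (\<Inter>j\<in>{m..<n}. char_polar (X j))"
      by (intro closed_INT ballI char_polar_closed)
    then show ?thesis unfolding C_def by (rule closed_Int_compact) (rule char_polar_compact)
  qed
  \<comment> \<open>Membership descends from \<open>char_polar (A n)\<close> to
    \<open>char_polar (A m)\<close>, one \<open>X j\<close> being used for each step.\<close>
  have C_sub: "char_polar (A n) \<inter> C m n \<subseteq> char_polar (A m)" if "m \<le> n" for m n
    using that
  proof (induction n rule: dec_induct)
    case (step n)
    have "C m (Suc n) \<subseteq> C m n \<inter> char_polar (X n)" using step.hyps by (auto simp: C_def)
    then show ?case using step.IH X(3)[of n] by blast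
  qed simp
  have "\<exists>Z. finite Z \<and> Z \<subseteq> A n \<and> (m \<le> n \<longrightarrow> char_polar Z \<inter> C m n \<subseteq> N m n)" for m n
  proof (cases "m \<le> n")
    case True
    have "char_polar (A n) \<inter> C m n \<subseteq> N m n"
      using C_sub[OF True] near_self unfolding N_def by blast
    from char_polar_finite_subset[OF C_compact N_open this] show ?thesis by metis
  qed auto
  then have "\<forall>m n. \<exists>Z. finite Z \<and> Z \<subseteq> A n \<and> (m \<le> n \<longrightarrow> char_polar Z \<inter> C m n \<subseteq> N m n)"
    by (intro allI)
  then obtain Z where "\<forall>m n. finite (Z m n) \<and> Z m n \<subseteq> A n \<and> (m \<le> n \<longrightarrow> char_polar (Z m n) \<inter> C m n \<subseteq> N m n)"
    unfolding choice_iff by (elim exE)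
  then have Z: "\<And>m n. finite (Z m n)" "\<And>m n. Z m n \<subseteq> A n"
    "\<And>m n. m \<le> n \<Longrightarrow> char_polar (Z m n) \<inter> C m n \<subseteq> N m n"
    by blast+
  define F where "F n = X n \<union> (\<Union>m\<in>{..n}. Z m n)" for n
  show ?thesis
  proof (intro exI[of _ F] conjI allI impI)
    show "finite (F n)" "F n \<subseteq> A n" for n
      using X(1)[of n] Z(1)[of _ n] X(2)[of n] Z(2)[of _ n] unfolding F_def by auto
    fix \<xi> m assume "\<forall>j\<ge>m. \<xi> \<in> char_polar (F j)"
    then have \<xi>: "\<And>j. m \<le> j \<Longrightarrow> \<xi> \<in> char_polar (F j)" by blast
    have N: "\<xi> \<in> N m n" if "m \<le> n" for n
    proof -
      have "\<xi> \<in> char_polar (Z m n)"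
        using \<xi>[OF that] char_polar_antimono[of "Z m n" "F n"] that by (auto simp: F_def)
      moreover have "\<xi> \<in> char_polar (X j)" if "m \<le> j" for j
        using \<xi>[OF that] char_polar_antimono[of "X j" "F j"] by (auto simp: F_def)
      then have "\<xi> \<in> C m n" using \<xi>[of m] by (auto simp: C_def char_polar_def)
      ultimately show ?thesis using Z(3)[OF that] by blast
    qed
    show "\<xi> \<in> char_polar (A m)"
    proof (rule ccontr)
      assume "\<xi> \<notin> char_polar (A m)"
      \<comment> \<open>As \<open>\<xi>\<close> differs from each of the finitely many
        \<open>\<kappa>\<close>, one large \<open>n\<close> separates it from all of them, against
        \<open>\<xi> \<in> N m n\<close>.\<close>
      have "\<exists>n0. \<forall>n\<ge>n0. \<xi> \<notin> near n \<kappa>" if "\<kappa> \<in> char_polar (A m)" for \<kappa>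
      proof -
        have "\<xi> \<noteq> \<kappa>" using that \<open>\<xi> \<notin> char_polar (A m)\<close> by blast
        then obtain i where i: "\<xi> (g i) \<noteq> \<kappa> (g i)" using surj by (metis ext)
        then obtain M where M: "1 / real (Suc M) < cmod (\<xi> (g i) - \<kappa> (g i))"
          using nat_approx_posE[of "cmod (\<xi> (g i) - \<kappa> (g i))"] by auto
        have "\<xi> \<notin> near n \<kappa>" if n: "max (Suc i) M \<le> n" for n
        proof
          assume "\<xi> \<in> near n \<kappa>"
          then have "cmod (\<xi> (g i) - \<kappa> (g i)) < 1 / real (Suc n)" using n by (auto simp: near_def)
          also have "\<dots> \<le> 1 / real (Suc M)" using n by (intro divide_left_mono) auto
          finally show False using M by simp
        qed
        then show ?thesis by blast
      qed
      then obtain n0 where n0: "\<And>\<kappa> n. \<kappa> \<in> char_polar (A m) \<Longrightarrow> n0 \<kappa> \<le> n \<Longrightarrow> \<xi> \<notin> near n \<kappa>" by metis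
      define n where "n = m + (\<Sum>\<kappa>\<in>char_polar (A m). n0 \<kappa>)"
      obtain \<kappa> where \<kappa>: "\<kappa> \<in> char_polar (A m)" "\<xi> \<in> near n \<kappa>" using N[of n] by (auto simp: N_def n_def)
      have "n0 \<kappa> \<le> n" unfolding n_def using \<kappa>(1) fin by (intro trans_le_add2 member_le_sum) auto
      then show False using n0 \<kappa> by blast
    qed
  qed
qed

text \<open>Connects the two measures of closeness to 1: \<open>cmod (\<xi> x - 1)\<close> for
  polars, \<open>1 - Re (\<xi> x)\<close> for positive definite functions.\<close>

lemma circle_char_norm_diff_1: "circle_char \<xi> \<Longrightarrow> (cmod (\<xi> x - 1))\<^sup>2 = 2 * (1 - Re (\<xi> x))"
  using circle_char_norm[of \<xi> x] cmod_power2[of "\<xi> x"]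
  by (simp add: cmod_power2 power2_diff)

section \<open>The null sequence and the maximality of \<open>T\<close>\<close>

theorem corollary1p11:
  fixes T :: "'a::ab_group_add topology"
  assumes "countable (UNIV :: 'a set)"
    and "tb_group_topology T"
    and "metrizable_space T"
  shows "\<exists>u :: nat \<Rightarrow> 'a. limitin T u 0 sequentially \<and> finest_tb_group_topology_null T u"
proof -
  have gT: "group_topology T" using assms(2) by (simp add: tb_group_topology_def)
  obtain A :: "nat \<Rightarrow> 'a set" where A: "\<And>n. nbhd_zero T (A n)" "\<And>m n. m \<le> n \<Longrightarrow> A n \<subseteq> A m"
    "\<And>U. nbhd_zero T U \<Longrightarrow> \<exists>n. A n \<subseteq> U"
    using metrizable_nbhd_zero_base[OF gT assms(3)] by blast
  have fin: "finite (char_polar (A n))" for n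
  proof -
    obtain F where "finite F" "UNIV \<subseteq> (\<Union>g\<in>F. (+) g ` A n)"
      by (rule tb_group_topology_cover[OF assms(2) A(1)])
    then show ?thesis by (rule finite_char_polar)
  qed
  obtain F where F: "\<forall>n. finite (F n)" "\<forall>n. F n \<subseteq> A n"
    "\<forall>\<xi> m. (\<forall>j\<ge>m. \<xi> \<in> char_polar (F j)) \<longrightarrow> \<xi> \<in> char_polar (A m)"
    using finite_blocks_determine_polars[of A, OF assms(1) fin] by (elim exE conjE)
  \<comment> \<open>Inserting \<open>0\<close> makes the blocks nonempty and does not affect
    convergence to \<open>0\<close>.\<close>
  obtain u where u: "\<And>P. (\<forall>\<^sub>F k in sequentially. P (u k)) \<longleftrightarrow> (\<forall>\<^sub>F n in sequentially. \<forall>x\<in>insert 0 (F n). P x)"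
    by (rule enumerate_finite_blocks[of "\<lambda>n. insert 0 (F n)"]) (use F(1) in auto)
  have lim: "limitin T u 0 sequentially"
    unfolding limitin_def
  proof (intro conjI allI impI)
    show "0 \<in> topspace T" using gT by (simp add: group_topology_def)
    fix U assume U: "openin T U \<and> 0 \<in> U"
    then obtain m where m: "A m \<subseteq> U" using A(3)[of U] by (auto simp: nbhd_zero_def)
    have "\<forall>x\<in>insert 0 (F n). x \<in> U" if "m \<le> n" for n
      using F(2) A(2)[OF that] m U by blast
    then have "\<forall>\<^sub>F n in sequentially. \<forall>x\<in>insert 0 (F n). x \<in> U"
      unfolding eventually_sequentially by blast
    then show "\<forall>\<^sub>F k in sequentially. u k \<in> U" by (rule iffD2[OF u])
  qed
  have "coarser_topology T' T" if T': "tb_group_topology T'" and lim': "limitin T' u 0 sequentially" for T'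
  proof (rule coarser_topology_nbhd_zero[OF gT])
    show gT': "group_topology T'" using T' by (simp add: tb_group_topology_def)
    fix U assume "nbhd_zero T' U"
    from tb_group_topology_circle_chars[OF T' this] obtain X e where X: "finite X" "0 < e"
      and X': "\<forall>\<xi>\<in>X. circle_char \<xi> \<and> (\<forall>r>0. nbhd_zero T' {x. 1 - Re (\<xi> x) < r})"
      and X_U: "{x. \<forall>\<xi>\<in>X. 1 - Re (\<xi> x) < e} \<subseteq> U"
      by (elim exE conjE)
    have X_char: "circle_char \<xi>" and X_cont: "0 < r \<Longrightarrow> nbhd_zero T' {x. 1 - Re (\<xi> x) < r}"
      if "\<xi> \<in> X" for \<xi> r
      using X' that by auto
    have "nbhd_zero T {x. cmod (\<xi> x - 1) < e}" if \<xi>: "\<xi> \<in> X" for \<xi>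
    proof -
      \<comment> \<open>Twice 1/32 is the square of 1/4, the radius in
        \<open>char_polar\<close>.\<close>
      obtain V where V: "openin T' V" "0 \<in> V" "V \<subseteq> {x. 1 - Re (\<xi> x) < 1 / 32}"
        using X_cont[OF \<xi>, of "1/32"] by (auto simp: nbhd_zero_def)
      have "\<forall>\<^sub>F k in sequentially. u k \<in> V" using lim' V by (simp add: limitin_def)
      then have "\<forall>\<^sub>F n in sequentially. \<forall>x\<in>insert 0 (F n). x \<in> V" by (rule iffD1[OF u])
      then obtain m where m: "\<And>j x. m \<le> j \<Longrightarrow> x \<in> F j \<Longrightarrow> x \<in> V" by (auto simp: eventually_sequentially)
      have "\<xi> \<in> char_polar (F j)" if "m \<le> j" for j
      proof -
        have "cmod (\<xi> x - 1) \<le> 1 / 4" if "x \<in> F j" for x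
        proof -
          have "1 - Re (\<xi> x) < 1 / 32" using m[OF \<open>m \<le> j\<close> that] V(3) by blast
          then have "(cmod (\<xi> x - 1))\<^sup>2 \<le> (1 / 4)\<^sup>2"
            unfolding circle_char_norm_diff_1[OF X_char[OF \<xi>]] by (simp add: power2_eq_square)
          then show ?thesis by (rule power2_le_imp_le) simp
        qed
        then show ?thesis using X_char[OF \<xi>] by (simp add: char_polar_def)
      qed
      \<comment> \<open>Here the choice of the blocks pays off: nullity of \<open>u\<close> in
        \<open>T'\<close> has put \<open>\<xi>\<close> into the polars of all blocks from
        \<open>m\<close> on, and the conclusion concerns a \<open>T\<close>-neighbourhood.\<close>
      then have "\<xi> \<in> char_polar (A m)" using F(3) by blast
      then have "A m \<subseteq> {x. cmod (\<xi> x - 1) \<le> 1 / 4}" by (auto simp: char_polar_def)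
      then show ?thesis
        using X(2) by (intro circle_char_continuous[OF gT X_char[OF \<xi>]] nbhd_zero_mono[OF A(1)])
    qed
    then have "nbhd_zero T (\<Inter>\<xi>\<in>X. {x. cmod (\<xi> x - 1) < e})"
      by (intro nbhd_zero_INT[OF gT X(1)])
    moreover have "(\<Inter>\<xi>\<in>X. {x. cmod (\<xi> x - 1) < e}) \<subseteq> U"
    proof (rule order_trans[OF _ X_U], clarify)
      fix x \<xi> assume "x \<in> (\<Inter>\<xi>\<in>X. {x. cmod (\<xi> x - 1) < e})" "\<xi> \<in> X"
      then have "cmod (\<xi> x - 1) < e" by blast
      then show "1 - Re (\<xi> x) < e" using abs_Re_le_cmod[of "\<xi> x - 1"] by simp
    qed
    ultimately show "nbhd_zero T U" by (rule nbhd_zero_mono)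
  qed
  then show ?thesis using assms(2) lim unfolding finest_tb_group_topology_null_def by blast
qed

end
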